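(* Let $h:[0,\infty)\to[0,\infty)$ be nondecreasing with $0<\int_1^\infty \frac{h(t)}{t^2}\,dt<\infty$, and let $X$ be a normed space of type 2. Then for all $n\ge1$ and all $f:\{-1,1\}^n\to X$, $$\|f-\mathbb{E}f\|_2\;\le\;12\,T_2(X)\left(\int_1^\infty\frac{h(t)}{t^2}\,dt\right)^{1/2}\left(\sum_{j=1}^n\frac{\|D_jf\|_2^2}{h\left(\log\frac{\|D_jf\|_2}{\|D_jf\|_1}\right)}\right)^{1/2}.$$
   Context: $\{-1,1\}^n$ carries the uniform probability measure, with expectation $\mathbb{E}$. For $f:\{-1,1\}^n\to X$ and $1\le q<\infty$, $\|f\|_q=(\mathbb{E}\|f(\varepsilon)\|^q)^{1/q}$. The discrete derivative is $D_jf(\varepsilon)=\frac{f(\varepsilon)-f(\varepsilon^{\oplus j})}{2}$, where $\varepsilon^{\oplus j}=(\varepsilon_1,\dots,-\varepsilon_j,\dots,\varepsilon_n)$. $\log$ is the natural logarithm. A normed space $X$ is of (Rademacher) type 2 if there is a finite constant $T$ such that $\mathbb{E}\|\sum_{j=1}^n\varepsilon_jx_j\|^2\le T^2\sum_{j=1}^n\|x_j\|^2$ for all $n\ge1$ and all $x_1,\dots,x_n\in X$, where $\varepsilon$ is uniform on $\{-1,1\}^n$. The best (smallest) such $T$ is $T_2(X)$. Conventions: terms of the sum with $D_jf\equiv0$ are read as $0$. A term with $\|D_jf\|_2>0$ and $h\big(\log\frac{\|D_jf\|_2}{\|D_jf\|_1}\big)=0$ is read as $+\infty$, in which case, provided $T_2(X)>0$,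 the right-hand side is $+\infty$. *)

theory Defs
  imports "HOL-Analysis.Analysis"
begin

text \<open>Points of the cube are extensional functions, so the cube is a finite set and
  functions on it are functions \<^typ>\<open>(nat \<Rightarrow> real) \<Rightarrow> 'a\<close> whose values outside it play no role.\<close>

definition cube :: "nat \<Rightarrow> (nat \<Rightarrow> real) set"
  where "cube n = {1..n} \<rightarrow>\<^sub>E {-1, 1}"

text \<open>The expectation is written as a finite average because the Bochner integral needs a complete
  and second countable codomain, which is not assumed of the normed space.\<close>

definition expect :: "nat \<Rightarrow> ((nat \<Rightarrow> real) \<Rightarrow> 'a) \<Rightarrow> 'a::real_vector"
  where "expect n g = (1 / real (card (cube n))) *\<^sub>R (\<Sum>\<epsilon>\<in>cube n. g \<epsilon>)"

definition cube_norm :: "nat \<Rightarrow> real \<Rightarrow> ((nat \<Rightarrow> real) \<Rightarrow> 'a::real_normed_vector) \<Rightarrow> real"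
  where "cube_norm n q f = expect n (\<lambda>\<epsilon>. norm (f \<epsilon>) powr q) powr (1 / q)"

definition flip :: "nat \<Rightarrow> (nat \<Rightarrow> real) \<Rightarrow> (nat \<Rightarrow> real)"
  where "flip j \<epsilon> = \<epsilon>(j := - \<epsilon> j)"

definition discrete_deriv ::
    "nat \<Rightarrow> ((nat \<Rightarrow> real) \<Rightarrow> 'a) \<Rightarrow> (nat \<Rightarrow> real) \<Rightarrow> 'a::real_vector"
  where "discrete_deriv j f \<epsilon> = (1 / 2) *\<^sub>R (f \<epsilon> - f (flip j \<epsilon>))"

definition type2_bound :: "'a::real_normed_vector itself \<Rightarrow> real \<Rightarrow> bool"
  where "type2_bound _ T \<longleftrightarrow>
    (\<forall>n\<ge>1. \<forall>x :: nat \<Rightarrow> 'a.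
      expect n (\<lambda>\<epsilon>. (norm (\<Sum>j = 1..n. \<epsilon> j *\<^sub>R x j))\<^sup>2) \<le> T\<^sup>2 * (\<Sum>j = 1..n. (norm (x j))\<^sup>2))"

definition has_type2 :: "'a::real_normed_vector itself \<Rightarrow> bool"
  where "has_type2 X \<longleftrightarrow> (\<exists>T\<ge>0. type2_bound X T)"

text \<open>Only \<^term>\<open>T\<^sup>2\<close> enters the bound, hence the explicit restriction to nonnegative constants.\<close>

definition type2_const :: "'a::real_normed_vector itself \<Rightarrow> real"
  where "type2_const X = Inf {T. 0 \<le> T \<and> type2_bound X T}"

definition ennreal_sqrt :: "ennreal \<Rightarrow> ennreal"
  where "ennreal_sqrt x = (if x = \<infinity> then \<infinity> else ennreal (sqrt (enn2real x)))"

text \<open>The \<open>j\<close>-th summand is infinite when its denominator vanishes and the derivative does not;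
  it is zero when the derivative vanishes on the cube, whatever the denominator.\<close>

definition talagrand_term ::
    "(real \<Rightarrow> real) \<Rightarrow> nat \<Rightarrow> ((nat \<Rightarrow> real) \<Rightarrow> 'a::real_normed_vector) \<Rightarrow> nat \<Rightarrow> ennreal"
  where "talagrand_term h n f j =
    (let D = discrete_deriv j f;
         d = h (ln (cube_norm n 2 D / cube_norm n 1 D))
     in if \<forall>\<epsilon>\<in>cube n. D \<epsilon> = 0 then 0
        else if d = 0 then \<infinity>
        else ennreal ((cube_norm n 2 D)\<^sup>2 / d))"

end

theory Submission
  imports Defs
begin

text \<open>The proof interpolates between \<open>f\<close> and its mean by the noise operators
  \<open>T\<^sub>r f(\<epsilon>) = E\<^sub>\<eta> k\<^sub>r(\<epsilon>, \<eta>) f(\<eta>)\<close>, where \<open>k\<^sub>r(\<epsilon>, \<eta>)\<close> is the product of the factors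
  \<open>1 + r \<epsilon>\<^sub>i \<eta>\<^sub>i\<close>: one has \<open>T\<^sub>1 f = f\<close> and \<open>T\<^sub>0 f = E f\<close>, and so
  \<open>f - E f\<close> is controlled by the velocity of the path \<open>u \<mapsto> T\<^sub>r T\<^sub>r f\<close>, \<open>r = cos(\<pi> u / 2)\<close>,
  \<open>0 \<le> u \<le> 1\<close>. By the semigroup law \<open>T\<^sub>r T\<^sub>s = T\<^sub>r\<^sub>s\<close> it is enough to differentiate one of
  the two operators, and then each of them has its own task.

  The differentiated operator makes the type of the space enter. With \<open>g = T\<^sub>r f\<close>, the derivative
  of \<open>s \<mapsto> T\<^sub>s g\<close> at \<open>r\<close> is the average of \<open>\<Sum>\<^sub>j (\<epsilon>\<^sub>j \<eta>\<^sub>j - r) D\<^sub>j g(\<eta>)\<close> against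
  \<open>k\<^sub>r(\<epsilon>, \<eta>) / (1 - r\<^sup>2)\<close>. For fixed \<open>\<eta>\<close> the numbers \<open>\<epsilon>\<^sub>j \<eta>\<^sub>j\<close> are, under the density
  \<open>k\<^sub>r(\<cdot>, \<eta>)\<close>, independent signs of mean \<open>r\<close>, so after a symmetrization type 2 bounds the second
  moment of the sum by \<open>2 (1 - r\<^sup>2) T\<^sup>2 \<Sum>\<^sub>j \<parallel>D\<^sub>j g(\<eta>)\<parallel>\<^sup>2\<close> (\<open>type2_biased_signs\<close>,
  \<open>noise_deriv_bound\<close>). The powers of \<open>1 - r\<^sup>2\<close> are absorbed by the trigonometric parametrization.

  The other operator smooths. It commutes with \<open>D\<^sub>j\<close>, and hypercontractivity followed by
  interpolation between the exponents 1 and 2 gives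
  \<open>\<parallel>T\<^sub>r D\<^sub>j f\<parallel>\<^sub>2\<^sup>2 \<le> \<parallel>D\<^sub>j f\<parallel>\<^sub>2\<^sup>2 exp(- L\<^sub>j (1 - r\<^sup>2))\<close>, \<open>L\<^sub>j\<close> being the logarithm of
  \<open>\<parallel>D\<^sub>j f\<parallel>\<^sub>2 / \<parallel>D\<^sub>j f\<parallel>\<^sub>1\<close> (\<open>noise_norm_decay\<close>). As \<open>1 - r\<^sup>2 = sin\<^sup>2(\<pi> u / 2) \<ge> u\<^sup>2\<close>, the
  velocity has second moment at most \<open>2 \<pi>\<^sup>2 T\<^sup>2 \<Sum>\<^sub>j \<parallel>D\<^sub>j f\<parallel>\<^sub>2\<^sup>2 exp(- L\<^sub>j u\<^sup>2)\<close>
  (\<open>noise_path_deriv_bound\<close>).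

  What remains is a Cauchy-Schwarz inequality in \<open>u\<close> with a weight that depends on \<open>h\<close>,
  \<open>W(u) = \<integral>\<^sub>1\<^sup>\<infinity> h(s) s\<^sup>-\<^sup>3\<^sup>/\<^sup>2 / (1 + s u\<^sup>2) ds\<close>. Integrating \<open>u\<close> out first, \<open>\<integral> W\<close> is at most
  \<open>\<pi>/2\<close> times the integral of \<open>h(s) / s\<^sup>2\<close>. Conversely, as \<open>h\<close> is nondecreasing, the
  range \<open>s \<ge> L\<close> alone shows that \<open>W(u)\<close> is at least a multiple of
  \<open>h(L) / (\<surd>L (1 + L u\<^sup>2))\<close> when \<open>L \<ge> 1\<close>, which makes the integral of \<open>exp(- L u\<^sup>2) / W(u)\<close>
  at most \<open>(9 \<pi> / 8) / h(L)\<close>, for \<open>L < 1\<close> too. The constants multiply to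
  \<open>2 \<pi>\<^sup>2 (\<pi> / 2) (9 \<pi> / 8) = 9 \<pi>\<^sup>4 / 8 \<le> 12\<^sup>2\<close>.\<close>

section \<open>Averages over the cube\<close>

lemma finite_cube [simp]: "finite (cube n)"
  unfolding cube_def by (intro finite_PiE) auto

lemma card_cube: "card (cube n) = 2 ^ n"
  unfolding cube_def by (subst card_PiE) (auto simp: numeral_2_eq_2)

lemma card_cube_pos [simp]: "0 < card (cube n)"
  by (simp add: card_cube)

lemma cube_nonempty [simp]: "cube n \<noteq> {}"
  using card_cube_pos[of n] by (metis card.empty less_irrefl)

lemma cube_coord: "\<epsilon> \<in> cube n \<Longrightarrow> j \<in> {1..n} \<Longrightarrow> \<epsilon> j = 1 \<or> \<epsilon> j = -1"
  using PiE_mem[of \<epsilon> "{1..n}" "\<lambda>_. {-1, 1}" j] by (auto simp: cube_def)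

lemma cube_coord_sq: "\<epsilon> \<in> cube n \<Longrightarrow> j \<in> {1..n} \<Longrightarrow> \<epsilon> j * \<epsilon> j = 1"
  using cube_coord by fastforce

lemma sum_cube_Suc:
  fixes g :: "(nat \<Rightarrow> real) \<Rightarrow> 'b::comm_monoid_add"
  shows "(\<Sum>\<epsilon>\<in>cube (Suc n). g \<epsilon>) =
    (\<Sum>\<epsilon>\<in>cube n. g (\<epsilon>(Suc n := 1)) + g (\<epsilon>(Suc n := -1)))"
proof -
  have set: "cube (Suc n) = (\<lambda>(y, e). e(Suc n := y)) ` ({-1, 1} \<times> cube n)"
  proof -
    have "{1..Suc n} = insert (Suc n) {1..n}" by auto
    then show ?thesis unfolding cube_def by (simp only: PiE_insert_eq)
  qed
  have inj: "inj_on (\<lambda>(y, e). e(Suc n := y)) ({-1, 1::real} \<times> cube n)"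
    unfolding cube_def by (rule inj_combinator[of _ _ "\<lambda>_. {-1, 1}"]) auto
  have "(\<Sum>\<epsilon>\<in>cube (Suc n). g \<epsilon>) = (\<Sum>(y, e)\<in>{-1, 1} \<times> cube n. g (e(Suc n := y)))"
    unfolding set by (subst sum.reindex[OF inj]) (simp add: case_prod_unfold)
  also have "\<dots> = (\<Sum>y\<in>{-1, 1}. \<Sum>e\<in>cube n. g (e(Suc n := y)))"
    by (simp add: sum.cartesian_product)
  also have "\<dots> = (\<Sum>\<epsilon>\<in>cube n. g (\<epsilon>(Suc n := 1)) + g (\<epsilon>(Suc n := -1)))"
    by (simp add: sum.distrib add.commute)
  finally show ?thesis .
qed

text \<open>The induction on the dimension behind hypercontractivity and the semigroup law.\<close>

lemma expect_Suc:
  "expect (Suc n) g =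
    expect n (\<lambda>\<epsilon>. (1 / 2) *\<^sub>R (g (\<epsilon>(Suc n := 1)) + g (\<epsilon>(Suc n := -1))))"
proof -
  have "expect (Suc n) g = (1 / 2 ^ Suc n) *\<^sub>R
      (\<Sum>\<epsilon>\<in>cube n. g (\<epsilon>(Suc n := 1)) + g (\<epsilon>(Suc n := -1)))"
    unfolding expect_def card_cube sum_cube_Suc by simp
  also have "\<dots> = (1 / 2 ^ n) *\<^sub>R
      (\<Sum>\<epsilon>\<in>cube n. (1 / 2) *\<^sub>R (g (\<epsilon>(Suc n := 1)) + g (\<epsilon>(Suc n := -1))))"
    unfolding scaleR_sum_right by (simp add: mult.commute)
  finally show ?thesis by (simp only: expect_def card_cube of_nat_power of_nat_numeral)
qed

lemma cube_0 [simp]: "cube 0 = {\<lambda>_. undefined}"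
  by (simp add: cube_def)

lemma expect_0 [simp]: "expect 0 g = g (\<lambda>_. undefined)"
  by (simp add: expect_def)

lemma expect_cong:
  "(\<And>\<epsilon>. \<epsilon> \<in> cube n \<Longrightarrow> g \<epsilon> = g' \<epsilon>) \<Longrightarrow> expect n g = expect n g'"
  by (simp add: expect_def cong: sum.cong)

lemma expect_add: "expect n (\<lambda>\<epsilon>. g \<epsilon> + g' \<epsilon>) = expect n g + expect n g'"
  by (simp add: expect_def sum.distrib scaleR_add_right)

lemma expect_diff: "expect n (\<lambda>\<epsilon>. g \<epsilon> - g' \<epsilon>) = expect n g - expect n g'"
  by (simp add: expect_def sum_subtractf scaleR_diff_right)

lemma expect_scaleR: "expect n (\<lambda>\<epsilon>. c *\<^sub>R g \<epsilon>) = c *\<^sub>R expect n g"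
  by (simp add: expect_def scaleR_sum_right mult.commute)

lemma expect_scaleR_left: "expect n (\<lambda>\<epsilon>. g \<epsilon> *\<^sub>R v) = expect n g *\<^sub>R v"
  by (simp add: expect_def scaleR_sum_left[symmetric])

lemma expect_sum: "expect n (\<lambda>\<epsilon>. \<Sum>j\<in>J. g j \<epsilon>) = (\<Sum>j\<in>J. expect n (g j))"
  unfolding expect_def by (subst sum.swap) (simp add: scaleR_sum_right)

lemma expect_mult: "expect n (\<lambda>\<epsilon>. c * g \<epsilon>) = (c::real) * expect n g"
  using expect_scaleR[of n c g] by simp

lemma expect_const [simp]: "expect n (\<lambda>_. c) = c"
  by (simp add: expect_def scaleR_sum_left[symmetric] sum_constant_scaleR)

lemma expect_mono:
  "(\<And>\<epsilon>. \<epsilon> \<in> cube n \<Longrightarrow> g \<epsilon> \<le> g' \<epsilon>) \<Longrightarrow> expect n g \<le> (expect n g' :: real)"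
  by (simp add: expect_def sum_mono divide_right_mono)

lemma expect_nonneg:
  "(\<And>\<epsilon>. \<epsilon> \<in> cube n \<Longrightarrow> 0 \<le> g \<epsilon>) \<Longrightarrow> 0 \<le> (expect n g :: real)"
  using expect_mono[of n "\<lambda>_. 0" g] by simp

lemma norm_expect_le: "norm (expect n g) \<le> expect n (\<lambda>\<epsilon>. norm (g \<epsilon>))"
  by (simp add: expect_def norm_sum divide_right_mono)

lemma expect_eq_0_iff:
  assumes "\<And>\<epsilon>. \<epsilon> \<in> cube n \<Longrightarrow> 0 \<le> g \<epsilon>"
  shows "expect n g = (0::real) \<longleftrightarrow> (\<forall>\<epsilon>\<in>cube n. g \<epsilon> = 0)"
  using sum_nonneg_eq_0_iff[of "cube n" g] assms
  by (simp add: expect_def card_cube)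

lemma expect_swap:
  "expect n (\<lambda>\<epsilon>. expect m (\<lambda>\<eta>. g \<epsilon> \<eta>)) = expect m (\<lambda>\<eta>. expect n (\<lambda>\<epsilon>. g \<epsilon> \<eta>))"
  unfolding expect_def scaleR_sum_right[symmetric]
  by (subst sum.swap) (simp add: mult.commute)

text \<open>Jensen's inequality for the squared norm under the probability density \<open>w\<close>.\<close>

lemma expect_norm_square_le:
  fixes g :: "(nat \<Rightarrow> real) \<Rightarrow> 'a::real_normed_vector"
  assumes w: "\<And>\<epsilon>. \<epsilon> \<in> cube n \<Longrightarrow> 0 \<le> w \<epsilon>" and w1: "expect n w = 1"
  shows "(norm (expect n (\<lambda>\<epsilon>. w \<epsilon> *\<^sub>R g \<epsilon>)))\<^sup>2 \<le> expect n (\<lambda>\<epsilon>. w \<epsilon> * (norm (g \<epsilon>))\<^sup>2)"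
proof -
  let ?N = "real (card (cube n))"
  have "norm (expect n (\<lambda>\<epsilon>. w \<epsilon> *\<^sub>R g \<epsilon>)) \<le> expect n (\<lambda>\<epsilon>. w \<epsilon> * norm (g \<epsilon>))"
    using norm_expect_le[of n "\<lambda>\<epsilon>. w \<epsilon> *\<^sub>R g \<epsilon>"] w by (simp cong: expect_cong)
  then have "(norm (expect n (\<lambda>\<epsilon>. w \<epsilon> *\<^sub>R g \<epsilon>)))\<^sup>2 \<le> (expect n (\<lambda>\<epsilon>. w \<epsilon> * norm (g \<epsilon>)))\<^sup>2"
    by (intro power_mono) auto
  also have "\<dots> = (1 / ?N)\<^sup>2 * (\<Sum>\<epsilon>\<in>cube n. sqrt (w \<epsilon>) * (sqrt (w \<epsilon>) * norm (g \<epsilon>)))\<^sup>2"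
    unfolding expect_def real_scaleR_def power_mult_distrib
    by (intro arg_cong[of _ _ "\<lambda>s. _ * s\<^sup>2"] sum.cong refl) (simp add: w mult.assoc[symmetric])
  also have "\<dots> \<le> (1 / ?N)\<^sup>2 * ((\<Sum>\<epsilon>\<in>cube n. (sqrt (w \<epsilon>))\<^sup>2) *
      (\<Sum>\<epsilon>\<in>cube n. (sqrt (w \<epsilon>) * norm (g \<epsilon>))\<^sup>2))"
    by (intro mult_left_mono Cauchy_Schwarz_ineq_sum) auto
  also have "\<dots> = expect n w * expect n (\<lambda>\<epsilon>. w \<epsilon> * (norm (g \<epsilon>))\<^sup>2)"
    by (simp add: expect_def power_mult_distrib w power2_eq_square[of "1 / _"] cong: sum.cong)
  finally show ?thesis by (simp add: w1)
qed

section \<open>The two-point inequality and Minkowski's inequality below exponent one\<close>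

text \<open>The three estimates below successively integrate the fact that \<open>t \<mapsto> t powr q\<close> is convex for
  \<open>q \<le> 0\<close>: the second derivative in \<open>x\<close> of \<open>(1 + x) powr p + (1 - x) powr p\<close> is at least its
  value at \<open>0\<close>. Convexity enters as the arithmetic-geometric mean inequality, the product of the
  two powers being at least \<open>1\<close> because \<open>(1 + x) (1 - x) \<le> 1\<close>.\<close>

lemma powr_neg_add_ge_2:
  fixes x q :: real
  assumes "0 \<le> x" "x < 1" "q \<le> 0"
  shows "2 \<le> (1 + x) powr q + (1 - x) powr q"
proof -
  let ?u = "(1 + x) powr q" and ?v = "(1 - x) powr q"
  have "?u * ?v = (1 - x\<^sup>2) powr q"
    using assms by (subst powr_mult[symmetric]) (auto simp: algebra_simps power2_eq_square)
  also have "(1 - x\<^sup>2) powr q \<ge> (1::real) powr q"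
    using assms by (intro powr_mono2') (auto simp: power_less_one_iff abs_square_less_1)
  finally have "1 \<le> ?u * ?v" by simp
  moreover have "4 * (?u * ?v) \<le> (?u + ?v)\<^sup>2"
    using zero_le_power2[of "?u - ?v"] by (simp add: power2_eq_square algebra_simps)
  ultimately have "2\<^sup>2 \<le> (?u + ?v)\<^sup>2" by simp
  then show ?thesis
    by (rule power2_le_imp_le) simp
qed

lemma powr_diff_ge:
  fixes x q :: real
  assumes x: "0 \<le> x" "x < 1" and q: "0 \<le> q" "q \<le> 1"
  shows "2 * q * x \<le> (1 + x) powr q - (1 - x) powr q"
proof -
  let ?m = "\<lambda>y. (1 + y) powr q - (1 - y) powr q - 2 * q * y"
  have "?m 0 \<le> ?m x"
  proof (rule DERIV_nonneg_imp_nondecreasing[OF x(1)])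
    fix y assume y: "0 \<le> y" "y \<le> x"
    have "(?m has_real_derivative (q * ((1 + y) powr (q - 1) + (1 - y) powr (q - 1) - 2))) (at y)"
      using x y by (auto intro!: derivative_eq_intros simp: algebra_simps)
    moreover have "0 \<le> q * ((1 + y) powr (q - 1) + (1 - y) powr (q - 1) - 2)"
      using powr_neg_add_ge_2[of y "q - 1"] x y q by simp
    ultimately show "\<exists>d. (?m has_real_derivative d) (at y) \<and> 0 \<le> d" by blast
  qed
  then show ?thesis by simp
qed

lemma powr_sum_ge:
  fixes x p :: real
  assumes x: "0 \<le> x" "x \<le> 1" and p: "1 \<le> p" "p \<le> 2"
  shows "2 + p * (p - 1) * x\<^sup>2 \<le> (1 + x) powr p + (1 - x) powr p"
proof -
  let ?m = "\<lambda>y. (1 + y) powr p + (1 - y) powr p - p * (p - 1) * y\<^sup>2"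
  have "?m 0 \<le> ?m x"
  proof (rule DERIV_nonneg_imp_increasing_open[OF x(1)])
    fix y assume y: "0 < y" "y < x"
    have "(?m has_real_derivative (p * ((1 + y) powr (p - 1) - (1 - y) powr (p - 1) - 2 * (p - 1) * y))) (at y)"
      using x y by (auto intro!: derivative_eq_intros simp: algebra_simps)
    moreover have "0 \<le> p * ((1 + y) powr (p - 1) - (1 - y) powr (p - 1) - 2 * (p - 1) * y)"
      using powr_diff_ge[of y "p - 1"] x y p by simp
    ultimately show "\<exists>d. (?m has_real_derivative d) (at y) \<and> 0 \<le> d" by blast
  next
    show "continuous_on {0..x} ?m"
      using x p by (intro continuous_intros continuous_on_powr') auto
  qed
  then show ?thesis by simp
qed

lemma powr_le_linear:
  fixes x r :: real
  assumes "0 \<le> x" "0 \<le> r" "r \<le> 1"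
  shows "x powr r \<le> r * x + (1 - r)"
  using Youngs_inequality_0[of r "1 - r" x 1] assms by (cases "x = 0") auto

lemma power2_powr_half:
  fixes x p :: real
  shows "(x\<^sup>2) powr (p / 2) = \<bar>x\<bar> powr p"
proof (cases "x = 0")
  case False
  then have "x\<^sup>2 = \<bar>x\<bar> powr 2" by simp
  then have "(x\<^sup>2) powr (p / 2) = (\<bar>x\<bar> powr 2) powr (p / 2)" by (simp only:)
  also have "\<dots> = \<bar>x\<bar> powr p" unfolding powr_powr by simp
  finally show ?thesis .
qed simp

text \<open>This is hypercontractivity on a single coordinate. After scaling to \<open>a = 1\<close>, \<open>b = x\<close>, both sides
  are compared with \<open>1 + p (p - 1) x\<^sup>2 / 2\<close>, which is the second-order expansion of the right-hand
  side and a tangent line, in \<open>x\<^sup>2\<close>, of the left-hand side.\<close>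

lemma two_point_inequality_ordered:
  fixes a b p :: real
  assumes p: "1 \<le> p" "p \<le> 2" and ab: "\<bar>b\<bar> \<le> \<bar>a\<bar>"
  shows "(a\<^sup>2 + (p - 1) * b\<^sup>2) powr (p / 2) \<le> (\<bar>a + b\<bar> powr p + \<bar>a - b\<bar> powr p) / 2"
proof (cases "a = 0")
  case True
  then show ?thesis using ab by simp
next
  case False
  define x where "x = \<bar>b\<bar> / \<bar>a\<bar>"
  have x: "0 \<le> x" "x \<le> 1" using False ab by (auto simp: x_def divide_simps)
  have b: "\<bar>b\<bar> = \<bar>a\<bar> * x" using False by (simp add: x_def)
  have "b\<^sup>2 = a\<^sup>2 * x\<^sup>2"
    using b by (metis power2_abs power_mult_distrib)
  then have "(a\<^sup>2 + (p - 1) * b\<^sup>2) powr (p / 2) = (a\<^sup>2 * (1 + (p - 1) * x\<^sup>2)) powr (p / 2)"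
    by (simp add: algebra_simps)
  also have "\<dots> = \<bar>a\<bar> powr p * (1 + (p - 1) * x\<^sup>2) powr (p / 2)"
    using p by (simp add: powr_mult power2_powr_half)
  also have "(1 + (p - 1) * x\<^sup>2) powr (p / 2) \<le> 1 + p / 2 * ((p - 1) * x\<^sup>2)"
  proof -
    have "0 \<le> 1 + (p - 1) * x\<^sup>2" using p by (intro add_nonneg_nonneg mult_nonneg_nonneg) auto
    from powr_le_linear[OF this, of "p / 2"] p show ?thesis by (simp add: distrib_left)
  qed
  also have "\<dots> \<le> ((1 + x) powr p + (1 - x) powr p) / 2"
    using powr_sum_ge[OF x p] by (simp add: algebra_simps)
  also have "\<bar>a\<bar> powr p * (((1 + x) powr p + (1 - x) powr p) / 2)
      = ((\<bar>a\<bar> + \<bar>b\<bar>) powr p + (\<bar>a\<bar> - \<bar>b\<bar>) powr p) / 2"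
  proof -
    have "\<bar>a\<bar> + \<bar>b\<bar> = \<bar>a\<bar> * (1 + x)" "\<bar>a\<bar> - \<bar>b\<bar> = \<bar>a\<bar> * (1 - x)"
      using b by (auto simp: algebra_simps)
    then show ?thesis using x by (simp only: powr_mult) (simp add: distrib_left)
  qed
  also have "(\<bar>a\<bar> + \<bar>b\<bar>) powr p + (\<bar>a\<bar> - \<bar>b\<bar>) powr p = \<bar>a + b\<bar> powr p + \<bar>a - b\<bar> powr p"
  proof -
    have "(\<bar>a\<bar> + \<bar>b\<bar> = \<bar>a + b\<bar> \<and> \<bar>a\<bar> - \<bar>b\<bar> = \<bar>a - b\<bar>) \<or>
          (\<bar>a\<bar> + \<bar>b\<bar> = \<bar>a - b\<bar> \<and> \<bar>a\<bar> - \<bar>b\<bar> = \<bar>a + b\<bar>)"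
      using ab by linarith
    then show ?thesis by auto
  qed
  finally show ?thesis by (simp add: mult_left_mono)
qed

text \<open>Exchanging \<open>a\<close> and \<open>b\<close> leaves the right-hand side alone, and putting the larger square
  without the factor \<open>p - 1 \<le> 1\<close> only increases the left-hand side.\<close>

lemma two_point_inequality:
  fixes a b p :: real
  assumes p: "1 \<le> p" "p \<le> 2"
  shows "(a\<^sup>2 + (p - 1) * b\<^sup>2) powr (p / 2) \<le> (\<bar>a + b\<bar> powr p + \<bar>a - b\<bar> powr p) / 2"
proof (cases "\<bar>b\<bar> \<le> \<bar>a\<bar>")
  case True
  then show ?thesis using two_point_inequality_ordered[OF p] by blast
next
  case False
  then have "a\<^sup>2 \<le> b\<^sup>2" by (simp add: abs_le_square_iff[symmetric])
  then have "(2 - p) * a\<^sup>2 \<le> (2 - p) * b\<^sup>2"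
    using p by (intro mult_left_mono) auto
  then have "a\<^sup>2 + (p - 1) * b\<^sup>2 \<le> b\<^sup>2 + (p - 1) * a\<^sup>2"
    by (simp add: algebra_simps)
  then have "(a\<^sup>2 + (p - 1) * b\<^sup>2) powr (p / 2) \<le> (b\<^sup>2 + (p - 1) * a\<^sup>2) powr (p / 2)"
    using p by (intro powr_mono2) auto
  also have "\<dots> \<le> (\<bar>b + a\<bar> powr p + \<bar>b - a\<bar> powr p) / 2"
    using False by (intro two_point_inequality_ordered[OF p]) auto
  finally show ?thesis by (simp add: add.commute abs_minus_commute)
qed

text \<open>Dividing \<open>u\<close> and \<open>v\<close> by their \<open>L\<^sup>r\<close> norms \<open>A\<close> and \<open>B\<close> turns the claim into the concavity of
  \<open>t \<mapsto> t powr r\<close> at the convex combination of \<open>u / A\<close> and \<open>v / B\<close> with weights proportional to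
  \<open>A\<close> and \<open>B\<close>.\<close>

lemma reverse_minkowski:
  fixes u v :: "(nat \<Rightarrow> real) \<Rightarrow> real"
  assumes r: "0 < r" "r \<le> 1"
    and u: "\<And>\<epsilon>. \<epsilon> \<in> cube n \<Longrightarrow> 0 \<le> u \<epsilon>" and v: "\<And>\<epsilon>. \<epsilon> \<in> cube n \<Longrightarrow> 0 \<le> v \<epsilon>"
  shows "expect n (\<lambda>\<epsilon>. u \<epsilon> powr r) powr (1 / r) + expect n (\<lambda>\<epsilon>. v \<epsilon> powr r) powr (1 / r)
    \<le> expect n (\<lambda>\<epsilon>. (u \<epsilon> + v \<epsilon>) powr r) powr (1 / r)"
proof -
  define A where "A = expect n (\<lambda>\<epsilon>. u \<epsilon> powr r) powr (1 / r)"
  define B where "B = expect n (\<lambda>\<epsilon>. v \<epsilon> powr r) powr (1 / r)"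
  define C where "C = expect n (\<lambda>\<epsilon>. (u \<epsilon> + v \<epsilon>) powr r)"
  have mono: "expect n (\<lambda>\<epsilon>. u \<epsilon> powr r) \<le> C" "expect n (\<lambda>\<epsilon>. v \<epsilon> powr r) \<le> C"
    unfolding C_def using u v r by (auto intro!: expect_mono powr_mono2)
  have nn: "0 \<le> expect n (\<lambda>\<epsilon>. u \<epsilon> powr r)" "0 \<le> expect n (\<lambda>\<epsilon>. v \<epsilon> powr r)"
    by (auto intro!: expect_nonneg)
  have "A + B \<le> C powr (1 / r)"
  proof (cases "A = 0 \<or> B = 0")
    case True
    then show ?thesis using mono nn r by (auto simp: A_def B_def intro!: powr_mono2)
  next
    case False
    then have AB: "0 < A" "0 < B" by (auto simp: A_def B_def)
    have Ar: "A powr r = expect n (\<lambda>\<epsilon>. u \<epsilon> powr r)" "B powr r = expect n (\<lambda>\<epsilon>. v \<epsilon> powr r)"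
      using r nn by (simp_all add: A_def B_def powr_powr)
    have "A * (u \<epsilon> / A) powr r + B * (v \<epsilon> / B) powr r
        \<le> (A + B) * ((u \<epsilon> + v \<epsilon>) / (A + B)) powr r" if e: "\<epsilon> \<in> cube n" for \<epsilon>
    proof (cases "u \<epsilon> + v \<epsilon> = 0")
      case True
      then have "u \<epsilon> = 0 \<and> v \<epsilon> = 0" using u[OF e] v[OF e] by linarith
      then show ?thesis by simp
    next
      case False
      define s where "s = (u \<epsilon> + v \<epsilon>) / (A + B)"
      have "0 < u \<epsilon> + v \<epsilon>" using False u[OF e] v[OF e] by linarith
      then have s: "0 < s" using AB by (simp add: s_def)
      \<comment> \<open>the tangent at \<open>s\<close> lies above the concave function \<open>t \<mapsto> t powr r\<close>\<close>
      have tangent: "x powr r \<le> s powr r * (r * (x / s) + (1 - r))" if "0 \<le> x" for x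
      proof -
        have "x powr r = s powr r * (x / s) powr r"
          using that s by (simp add: powr_mult[symmetric])
        also have "\<dots> \<le> s powr r * (r * (x / s) + (1 - r))"
          using powr_le_linear[of "x / s" r] that s r by (intro mult_left_mono) auto
        finally show ?thesis .
      qed
      have "A * (u \<epsilon> / A) powr r + B * (v \<epsilon> / B) powr r
        \<le> A * (s powr r * (r * (u \<epsilon> / A / s) + (1 - r)))
          + B * (s powr r * (r * (v \<epsilon> / B / s) + (1 - r)))"
        using AB u[OF e] v[OF e] by (intro add_mono mult_left_mono tangent) auto
      also have "\<dots> = s powr r * (r * ((u \<epsilon> + v \<epsilon>) / s) + (1 - r) * (A + B))"
        using AB s by (simp add: field_simps)
      also have "(u \<epsilon> + v \<epsilon>) / s = A + B"
        using AB False by (simp add: s_def)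
      also have "s powr r * (r * (A + B) + (1 - r) * (A + B)) = (A + B) * s powr r"
        by (simp add: algebra_simps)
      finally show ?thesis by (simp add: s_def)
    qed
    then have "expect n (\<lambda>\<epsilon>. A * (u \<epsilon> / A) powr r + B * (v \<epsilon> / B) powr r)
        \<le> expect n (\<lambda>\<epsilon>. (A + B) * ((u \<epsilon> + v \<epsilon>) / (A + B)) powr r)"
      by (rule expect_mono)
    moreover have "expect n (\<lambda>\<epsilon>. (g \<epsilon> / c) powr r) = expect n (\<lambda>\<epsilon>. g \<epsilon> powr r) / c powr r"
      if "0 < c" "\<And>\<epsilon>. \<epsilon> \<in> cube n \<Longrightarrow> 0 \<le> g \<epsilon>" for c g
      using expect_mult[of n "1 / c powr r" "\<lambda>\<epsilon>. g \<epsilon> powr r"] that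
      by (simp add: powr_divide cong: expect_cong)
    ultimately have "A * (expect n (\<lambda>\<epsilon>. u \<epsilon> powr r) / A powr r)
        + B * (expect n (\<lambda>\<epsilon>. v \<epsilon> powr r) / B powr r)
      \<le> (A + B) * (C / (A + B) powr r)"
      using u v AB by (simp add: expect_add expect_mult C_def)
    then have "A + B \<le> (A + B) * (C / (A + B) powr r)"
      using AB unfolding Ar[symmetric] by simp
    then have "(A + B) * 1 \<le> (A + B) * (C / (A + B) powr r)" by simp
    then have "1 \<le> C / (A + B) powr r"
      by (rule mult_left_le_imp_le) (use AB in simp)
    then have "(A + B) powr r \<le> C" using AB by (simp add: field_simps)
    then have "((A + B) powr r) powr (1 / r) \<le> C powr (1 / r)"
      using r by (intro powr_mono2) auto
    then show ?thesis using AB r by (simp add: powr_powr)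
  qed
  then show ?thesis by (simp add: A_def B_def C_def)
qed

section \<open>The noise operator and its hypercontractivity\<close>

definition noise_kernel :: "nat \<Rightarrow> real \<Rightarrow> (nat \<Rightarrow> real) \<Rightarrow> (nat \<Rightarrow> real) \<Rightarrow> real"
  where "noise_kernel n r \<epsilon> \<eta> = (\<Prod>i = 1..n. 1 + r * \<epsilon> i * \<eta> i)"

definition noise ::
    "nat \<Rightarrow> real \<Rightarrow> ((nat \<Rightarrow> real) \<Rightarrow> 'a::real_vector) \<Rightarrow> (nat \<Rightarrow> real) \<Rightarrow> 'a"
  where "noise n r g \<epsilon> = expect n (\<lambda>\<eta>. noise_kernel n r \<epsilon> \<eta> *\<^sub>R g \<eta>)"

lemma noise_kernel_0 [simp]: "noise_kernel 0 r \<epsilon> \<eta> = 1"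
  by (simp add: noise_kernel_def)

lemma noise_kernel_Suc:
  "noise_kernel (Suc n) r \<epsilon> \<eta> = noise_kernel n r \<epsilon> \<eta> * (1 + r * \<epsilon> (Suc n) * \<eta> (Suc n))"
  by (simp add: noise_kernel_def)

lemma noise_kernel_upd [simp]:
  "noise_kernel n r (\<epsilon>(Suc n := x)) \<eta> = noise_kernel n r \<epsilon> \<eta>"
  "noise_kernel n r \<epsilon> (\<eta>(Suc n := x)) = noise_kernel n r \<epsilon> \<eta>"
  unfolding noise_kernel_def by (auto intro!: prod.cong)

lemma noise_kernel_commute: "noise_kernel n r \<epsilon> \<eta> = noise_kernel n r \<eta> \<epsilon>"
  by (simp add: noise_kernel_def mult_ac)

lemma noise_kernel_at_0 [simp]: "noise_kernel n 0 \<epsilon> \<eta> = 1"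
  by (simp add: noise_kernel_def)

text \<open>The semigroup law. It holds for arbitrary vectors \<open>\<epsilon>\<close> and \<open>\<zeta>\<close>, as only the average over \<open>\<eta>\<close> is
  used; \<open>s = 0\<close> shows that the kernel averages to one.\<close>

lemma noise_kernel_compose:
  "expect n (\<lambda>\<eta>. noise_kernel n r \<epsilon> \<eta> * noise_kernel n s \<eta> \<zeta>) = noise_kernel n (r * s) \<epsilon> \<zeta>"
proof (induction n)
  case (Suc n)
  have "expect (Suc n) (\<lambda>\<eta>. noise_kernel (Suc n) r \<epsilon> \<eta> * noise_kernel (Suc n) s \<eta> \<zeta>)
    = expect n (\<lambda>\<eta>. (1 + r * s * \<epsilon> (Suc n) * \<zeta> (Suc n)) *
        (noise_kernel n r \<epsilon> \<eta> * noise_kernel n s \<eta> \<zeta>))"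
    unfolding expect_Suc noise_kernel_Suc by (intro expect_cong) (simp add: algebra_simps)
  also have "\<dots> = noise_kernel (Suc n) (r * s) \<epsilon> \<zeta>"
    unfolding expect_mult Suc noise_kernel_Suc by (simp add: mult_ac)
  finally show ?case .
qed simp

lemma expect_noise_kernel: "expect n (noise_kernel n r \<epsilon>) = 1"
  using noise_kernel_compose[of n r \<epsilon> 0] by simp

lemma expect_noise_kernel': "expect n (\<lambda>\<epsilon>. noise_kernel n r \<epsilon> \<eta>) = 1"
  using expect_noise_kernel[of n r \<eta>] by (subst noise_kernel_commute)

lemma noise_kernel_nonneg:
  assumes "\<bar>r\<bar> \<le> 1" "\<epsilon> \<in> cube n" "\<eta> \<in> cube n"
  shows "0 \<le> noise_kernel n r \<epsilon> \<eta>"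
  unfolding noise_kernel_def
proof (rule prod_nonneg)
  fix i assume i: "i \<in> {1..n}"
  show "0 \<le> 1 + r * \<epsilon> i * \<eta> i"
    using cube_coord[OF assms(2) i] cube_coord[OF assms(3) i] assms(1) by auto
qed

lemma noise_Suc:
  fixes g :: "(nat \<Rightarrow> real) \<Rightarrow> real"
  shows "noise (Suc n) r g (\<epsilon>(Suc n := x)) =
    noise n r (\<lambda>\<eta>. (g (\<eta>(Suc n := 1)) + g (\<eta>(Suc n := -1))) / 2) \<epsilon>
    + r * x * noise n r (\<lambda>\<eta>. (g (\<eta>(Suc n := 1)) - g (\<eta>(Suc n := -1))) / 2) \<epsilon>"
  unfolding noise_def expect_Suc expect_mult[symmetric] expect_add[symmetric] noise_kernel_Suc
  by (intro expect_cong) (simp add: field_simps)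

text \<open>Induction on the dimension. Splitting off the last coordinate, \<open>g = a + \<epsilon> b\<close>, the operator acts as
  \<open>T a + r \<epsilon> T b\<close>, whose second moment is that of \<open>T a\<close> plus \<open>r\<^sup>2\<close> times that of \<open>T b\<close>. The
  induction hypothesis applies to \<open>a\<close> and \<open>b\<close> separately; the two \<open>L\<^sup>p\<close> norms are merged by the
  reverse Minkowski inequality with exponent \<open>p / 2\<close>, after which the two-point inequality acts
  pointwise. The exponent \<open>p = 1 + r\<^sup>2\<close> is the one for which \<open>r\<^sup>2 = p - 1\<close>.\<close>

lemma hypercontractivity:
  fixes g :: "(nat \<Rightarrow> real) \<Rightarrow> real"
  assumes r: "\<bar>r\<bar> \<le> 1"
  shows "expect n (\<lambda>\<epsilon>. (noise n r g \<epsilon>)\<^sup>2)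
    \<le> expect n (\<lambda>\<epsilon>. \<bar>g \<epsilon>\<bar> powr (1 + r\<^sup>2)) powr (2 / (1 + r\<^sup>2))"
proof (induction n arbitrary: g)
  case 0
  have "g x \<noteq> 0 \<Longrightarrow> (\<bar>g x\<bar> powr (1 + r\<^sup>2)) powr (2 / (1 + r\<^sup>2)) = (g x)\<^sup>2" for x
  proof -
    assume "g x \<noteq> 0"
    moreover have "(1 + r\<^sup>2) * (2 / (1 + r\<^sup>2)) = 2"
    proof -
      have "1 + r\<^sup>2 \<noteq> 0" using zero_le_power2[of r] by linarith
      then show ?thesis by (simp add: field_simps)
    qed
    ultimately show ?thesis unfolding powr_powr by simp
  qed
  then show ?case by (cases "g (\<lambda>_. undefined) = 0") (simp_all add: noise_def)
next
  case (Suc n)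
  define p where "p = 1 + r\<^sup>2"
  have p: "1 \<le> p" "p \<le> 2" using r by (auto simp: p_def abs_square_le_1)
  define a where "a = (\<lambda>\<eta>. (g (\<eta>(Suc n := 1)) + g (\<eta>(Suc n := -1))) / 2)"
  define b where "b = (\<lambda>\<eta>. (g (\<eta>(Suc n := 1)) - g (\<eta>(Suc n := -1))) / 2)"
  have "expect (Suc n) (\<lambda>\<epsilon>. (noise (Suc n) r g \<epsilon>)\<^sup>2)
      = expect n (\<lambda>\<epsilon>. (noise n r a \<epsilon>)\<^sup>2 + r\<^sup>2 * (noise n r b \<epsilon>)\<^sup>2)"
    unfolding expect_Suc noise_Suc a_def[symmetric] b_def[symmetric]
    by (intro expect_cong) (simp add: power2_eq_square algebra_simps)
  also have "\<dots> = expect n (\<lambda>\<epsilon>. (noise n r a \<epsilon>)\<^sup>2) + r\<^sup>2 * expect n (\<lambda>\<epsilon>. (noise n r b \<epsilon>)\<^sup>2)"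
    by (simp add: expect_add expect_mult)
  also have "\<dots> \<le> expect n (\<lambda>\<epsilon>. \<bar>a \<epsilon>\<bar> powr p) powr (2 / p)
      + r\<^sup>2 * expect n (\<lambda>\<epsilon>. \<bar>b \<epsilon>\<bar> powr p) powr (2 / p)"
    unfolding p_def by (intro add_mono mult_left_mono Suc) simp
  also have "\<dots> = expect n (\<lambda>\<epsilon>. ((a \<epsilon>)\<^sup>2) powr (p / 2)) powr (1 / (p / 2))
      + expect n (\<lambda>\<epsilon>. (r\<^sup>2 * (b \<epsilon>)\<^sup>2) powr (p / 2)) powr (1 / (p / 2))"
  proof -
    have "expect n (\<lambda>\<epsilon>. \<bar>b \<epsilon>\<bar> powr p) \<ge> 0" by (intro expect_nonneg) simp
    moreover have r2: "(\<bar>r\<bar> powr p) powr (2 / p) = r\<^sup>2"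
      using p by (simp add: power2_powr_half[symmetric] powr_powr)
    ultimately have "(\<bar>r\<bar> powr p * expect n (\<lambda>\<epsilon>. \<bar>b \<epsilon>\<bar> powr p)) powr (2 / p)
        = r\<^sup>2 * expect n (\<lambda>\<epsilon>. \<bar>b \<epsilon>\<bar> powr p) powr (2 / p)"
      using p r2 by (simp add: powr_mult)
    then show ?thesis
      using p r2 by (simp add: powr_mult power2_powr_half expect_mult)
  qed
  also have "\<dots> \<le> expect n (\<lambda>\<epsilon>. ((a \<epsilon>)\<^sup>2 + r\<^sup>2 * (b \<epsilon>)\<^sup>2) powr (p / 2)) powr (1 / (p / 2))"
    using p by (intro reverse_minkowski) auto
  also have "\<dots> \<le> expect n (\<lambda>\<epsilon>. (\<bar>a \<epsilon> + b \<epsilon>\<bar> powr p + \<bar>a \<epsilon> - b \<epsilon>\<bar> powr p) / 2) powr (1 / (p / 2))"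
    using p two_point_inequality[OF p]
    by (intro powr_mono2 expect_mono expect_nonneg) (auto simp: p_def)
  also have "\<dots> = expect (Suc n) (\<lambda>\<epsilon>. \<bar>g \<epsilon>\<bar> powr p) powr (2 / p)"
    unfolding expect_Suc by (simp add: a_def b_def field_simps)
  finally show ?case unfolding p_def .
qed

text \<open>Hoelder's inequality for \<open>g powr p = (g\<^sup>2) powr (p - 1) * g powr (2 - p)\<close>, obtained by averaging
  Young's inequality for the normalized functions.\<close>

lemma expect_powr_interpolate:
  fixes g :: "(nat \<Rightarrow> real) \<Rightarrow> real"
  assumes p: "1 \<le> p" "p \<le> 2"
    and g: "\<And>\<epsilon>. \<epsilon> \<in> cube n \<Longrightarrow> 0 \<le> g \<epsilon>" and pos: "0 < expect n g"
  shows "expect n (\<lambda>\<epsilon>. g \<epsilon> powr p)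
    \<le> expect n (\<lambda>\<epsilon>. (g \<epsilon>)\<^sup>2) powr (p - 1) * expect n g powr (2 - p)"
proof -
  define A where "A = expect n (\<lambda>\<epsilon>. (g \<epsilon>)\<^sup>2)"
  define B where "B = expect n g"
  have B: "0 < B" using pos by (simp add: B_def)
  have "A \<noteq> 0"
  proof
    assume "A = 0"
    then have "\<forall>\<epsilon>\<in>cube n. g \<epsilon> = 0"
      unfolding A_def using expect_eq_0_iff[of n "\<lambda>\<epsilon>. (g \<epsilon>)\<^sup>2"] by simp
    then have "B = 0" unfolding B_def using g by (subst expect_eq_0_iff) auto
    then show False using B by simp
  qed
  moreover have "0 \<le> A" unfolding A_def by (intro expect_nonneg) auto
  ultimately have A: "0 < A" by simp
  have "g \<epsilon> powr p \<le> A powr (p - 1) * B powr (2 - p) *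
      ((p - 1) * ((g \<epsilon>)\<^sup>2 / A) + (2 - p) * (g \<epsilon> / B))" if e: "\<epsilon> \<in> cube n" for \<epsilon>
  proof (cases "g \<epsilon> = 0")
    case False
    then have x: "0 < g \<epsilon>" using g[OF e] by simp
    have "g \<epsilon> powr p = (g \<epsilon>)\<^sup>2 powr (p - 1) * g \<epsilon> powr (2 - p)"
    proof -
      have "(g \<epsilon>)\<^sup>2 powr (p - 1) = (g \<epsilon> powr 2) powr (p - 1)" using x by simp
      also have "\<dots> = g \<epsilon> powr (2 * (p - 1))" by (rule powr_powr)
      finally show ?thesis by (simp add: powr_add[symmetric])
    qed
    also have "\<dots> = A powr (p - 1) * B powr (2 - p) *
        (((g \<epsilon>)\<^sup>2 / A) powr (p - 1) * (g \<epsilon> / B) powr (2 - p))"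
      using A B x by (simp add: powr_divide)
    also have "\<dots> \<le> A powr (p - 1) * B powr (2 - p) *
        ((p - 1) * ((g \<epsilon>)\<^sup>2 / A) + (2 - p) * (g \<epsilon> / B))"
      using A B x p by (intro mult_left_mono Youngs_inequality_0) auto
    finally show ?thesis .
  qed simp
  then have "expect n (\<lambda>\<epsilon>. g \<epsilon> powr p) \<le> expect n (\<lambda>\<epsilon>. A powr (p - 1) * B powr (2 - p) *
      ((p - 1) / A * (g \<epsilon>)\<^sup>2 + (2 - p) / B * g \<epsilon>))"
    by (intro expect_mono) simp
  also have "\<dots> = A powr (p - 1) * B powr (2 - p) * ((p - 1) / A * A + (2 - p) / B * B)"
    unfolding expect_mult expect_add A_def[symmetric] B_def[symmetric] ..
  also have "\<dots> = A powr (p - 1) * B powr (2 - p)"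
    using A B by simp
  finally show ?thesis by (simp add: A_def B_def)
qed

lemma cube_norm_2: "cube_norm n 2 g = sqrt (expect n (\<lambda>\<epsilon>. (norm (g \<epsilon>))\<^sup>2))"
  unfolding cube_norm_def by (simp add: powr_half_sqrt expect_nonneg)

lemma cube_norm_2_sq: "(cube_norm n 2 g)\<^sup>2 = expect n (\<lambda>\<epsilon>. (norm (g \<epsilon>))\<^sup>2)"
  by (simp add: cube_norm_2 expect_nonneg)

lemma cube_norm_1: "cube_norm n 1 g = expect n (\<lambda>\<epsilon>. norm (g \<epsilon>))"
  unfolding cube_norm_def by (simp add: expect_nonneg)

lemma cube_norm_1_pos:
  assumes "\<not> (\<forall>\<epsilon>\<in>cube n. g \<epsilon> = 0)"
  shows "0 < cube_norm n 1 g"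
proof -
  have "0 \<le> cube_norm n 1 g" "cube_norm n 1 g \<noteq> 0"
    unfolding cube_norm_1 using assms by (auto simp: expect_eq_0_iff intro!: expect_nonneg)
  then show ?thesis by simp
qed

lemma cube_norm_1_le_2: "cube_norm n 1 g \<le> cube_norm n 2 g"
  using expect_norm_square_le[of n "\<lambda>_. 1" "\<lambda>\<epsilon>. norm (g \<epsilon>)"]
  by (auto simp: cube_norm_1 cube_norm_2 expect_nonneg intro!: real_le_rsqrt)

lemma log_norm_ratio_nonneg:
  assumes "\<not> (\<forall>\<epsilon>\<in>cube n. g \<epsilon> = 0)"
  shows "0 \<le> ln (cube_norm n 2 g / cube_norm n 1 g)"
  using cube_norm_1_pos[OF assms] cube_norm_1_le_2[of n g] by (intro ln_ge_zero) simp

text \<open>The norm passes inside the kernel, so the scalar hypercontractive inequality applies to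
  \<open>norm \<circ> g\<close>. Interpolating \<open>L\<^sup>p\<close> between \<open>L\<^sup>1\<close> and \<open>L\<^sup>2\<close> with \<open>p = 1 + r\<^sup>2\<close> produces the rate
  \<open>2 (1 - r\<^sup>2) / (1 + r\<^sup>2)\<close>, which is at least \<open>1 - r\<^sup>2\<close>.\<close>

lemma noise_norm_decay:
  fixes g :: "(nat \<Rightarrow> real) \<Rightarrow> 'a::real_normed_vector"
  assumes r: "\<bar>r\<bar> \<le> 1" and g: "\<not> (\<forall>\<epsilon>\<in>cube n. g \<epsilon> = 0)"
  shows "expect n (\<lambda>\<epsilon>. (norm (noise n r g \<epsilon>))\<^sup>2)
    \<le> (cube_norm n 2 g)\<^sup>2 * exp (- ln (cube_norm n 2 g / cube_norm n 1 g) * (1 - r\<^sup>2))"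
proof -
  define p where "p = 1 + r\<^sup>2"
  have p: "1 \<le> p" "p \<le> 2" using r by (auto simp: p_def abs_square_le_1)
  define A where "A = cube_norm n 2 g"
  define B where "B = cube_norm n 1 g"
  have B: "0 < B" using cube_norm_1_pos[OF g] by (simp add: B_def)
  have A: "0 < A" using B cube_norm_1_le_2[of n g] by (simp add: A_def B_def)
  have A2: "expect n (\<lambda>\<epsilon>. (norm (g \<epsilon>))\<^sup>2) = A powr 2"
    using A by (simp add: A_def cube_norm_2_sq[symmetric])
  define L where "L = ln (A / B)"
  have L: "0 \<le> L" unfolding L_def A_def B_def by (rule log_norm_ratio_nonneg[OF g])
  have "expect n (\<lambda>\<epsilon>. (norm (noise n r g \<epsilon>))\<^sup>2) \<le> expect n (\<lambda>\<epsilon>. (noise n r (\<lambda>\<eta>. norm (g \<eta>)) \<epsilon>)\<^sup>2)"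
  proof (intro expect_mono power_mono norm_ge_zero)
    fix \<epsilon> assume e: "\<epsilon> \<in> cube n"
    have "norm (noise n r g \<epsilon>) \<le> expect n (\<lambda>\<eta>. norm (noise_kernel n r \<epsilon> \<eta> *\<^sub>R g \<eta>))"
      unfolding noise_def by (rule norm_expect_le)
    also have "\<dots> = noise n r (\<lambda>\<eta>. norm (g \<eta>)) \<epsilon>"
      unfolding noise_def by (intro expect_cong) (simp add: noise_kernel_nonneg[OF r e])
    finally show "norm (noise n r g \<epsilon>) \<le> noise n r (\<lambda>\<eta>. norm (g \<eta>)) \<epsilon>" .
  qed
  also have "\<dots> \<le> expect n (\<lambda>\<epsilon>. norm (g \<epsilon>) powr p) powr (2 / p)"
    using hypercontractivity[OF r, of n "\<lambda>\<eta>. norm (g \<eta>)"] by (simp add: p_def)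
  also have "\<dots> \<le> (expect n (\<lambda>\<epsilon>. (norm (g \<epsilon>))\<^sup>2) powr (p - 1) *
      expect n (\<lambda>\<epsilon>. norm (g \<epsilon>)) powr (2 - p)) powr (2 / p)"
    using p B by (intro powr_mono2 expect_powr_interpolate expect_nonneg) (auto simp: B_def cube_norm_1)
  also have "\<dots> = (A powr (2 * (p - 1)) * B powr (2 - p)) powr (2 / p)"
    unfolding A2 powr_powr B_def cube_norm_1 ..
  also have "\<dots> = exp ((2 * (p - 1) * ln A + (2 - p) * ln B) * (2 / p))"
    using A B by (simp add: powr_def exp_add[symmetric])
  also have "(2 * (p - 1) * ln A + (2 - p) * ln B) * (2 / p) = 2 * ln A - L * ((2 - p) * (2 / p))"
    using A B p by (simp add: L_def ln_div field_simps)
  also have "exp \<dots> \<le> exp (2 * ln A - L * (2 - p))"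
  proof -
    have "(2 - p) * 1 \<le> (2 - p) * (2 / p)" using p by (intro mult_left_mono) auto
    then have "L * (2 - p) \<le> L * ((2 - p) * (2 / p))" using L by (intro mult_left_mono) auto
    then show ?thesis by simp
  qed
  also have "\<dots> = A\<^sup>2 * exp (- L * (1 - r\<^sup>2))"
    using A by (simp add: p_def exp_diff exp_minus divide_inverse exp_double)
  finally show ?thesis by (simp add: A_def B_def L_def)
qed

section \<open>Differentiating the noise operator in its parameter\<close>

lemma flip_flip [simp]: "flip j (flip j \<epsilon>) = \<epsilon>"
  by (auto simp: flip_def)

lemma flip_same [simp]: "flip j \<epsilon> j = - \<epsilon> j"
  by (simp add: flip_def)

lemma flip_in_cube [simp]: "j \<in> {1..n} \<Longrightarrow> \<epsilon> \<in> cube n \<Longrightarrow> flip j \<epsilon> \<in> cube n"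
  unfolding cube_def flip_def by (auto simp: PiE_iff extensional_def)

lemma expect_flip:
  assumes "j \<in> {1..n}"
  shows "expect n (\<lambda>\<epsilon>. g (flip j \<epsilon>)) = expect n g"
  unfolding expect_def using assms
  by (intro arg_cong[of _ _ "scaleR _"] sum.reindex_bij_witness[of _ "flip j" "flip j"]) auto

lemma noise_kernel_flip:
  "noise_kernel n r (flip j \<epsilon>) \<eta> = noise_kernel n r \<epsilon> (flip j \<eta>)"
  unfolding noise_kernel_def flip_def by (intro prod.cong) auto

lemma discrete_deriv_noise:
  assumes j: "j \<in> {1..n}"
  shows "discrete_deriv j (noise n r f) \<epsilon> = noise n r (discrete_deriv j f) \<epsilon>"
proof -
  have "noise n r f (flip j \<epsilon>) = expect n (\<lambda>\<eta>. noise_kernel n r \<epsilon> \<eta> *\<^sub>R f (flip j \<eta>))"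
    using expect_flip[OF j, of "\<lambda>\<eta>. noise_kernel n r \<epsilon> (flip j \<eta>) *\<^sub>R f \<eta>"]
    by (simp add: noise_def noise_kernel_flip)
  then show ?thesis
    unfolding discrete_deriv_def noise_def
    by (simp add: expect_diff[symmetric] expect_scaleR[symmetric] scaleR_diff_right mult.commute)
qed

lemma noise_kernel_split:
  assumes "j \<in> {1..n}"
  shows "noise_kernel n r \<epsilon> \<eta> = (1 + r * (\<epsilon> j * \<eta> j)) * (\<Prod>i\<in>{1..n} - {j}. 1 + r * \<epsilon> i * \<eta> i)"
  unfolding noise_kernel_def using prod.remove[OF _ assms, of "\<lambda>i. 1 + r * \<epsilon> i * \<eta> i"]
  by (simp add: mult.assoc)

lemma noise_kernel_flip_cancel:
  assumes j: "j \<in> {1..n}" and \<epsilon>: "\<epsilon> \<in> cube n" and \<eta>: "\<eta> \<in> cube n"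
  shows "noise_kernel n r \<epsilon> (flip j \<eta>) * (\<epsilon> j * flip j \<eta> j - r)
    = - (noise_kernel n r \<epsilon> \<eta> * (\<epsilon> j * \<eta> j - r))"
proof -
  define x where "x = \<epsilon> j * \<eta> j"
  define R where "R = (\<Prod>i\<in>{1..n} - {j}. 1 + r * \<epsilon> i * \<eta> i)"
  have R: "(\<Prod>i\<in>{1..n} - {j}. 1 + r * \<epsilon> i * flip j \<eta> i) = R"
    unfolding R_def by (intro prod.cong) (auto simp: flip_def)
  have xx: "x * x = 1"
    using cube_coord_sq[OF \<epsilon> j] cube_coord_sq[OF \<eta> j] by (simp add: x_def mult_ac)
  have "(1 + r * - x) * (- x - r) = - ((1 + r * x) * (x - r)) + 2 * r * (x * x - 1)"
    by (simp add: algebra_simps)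
  then have eq: "(1 + r * - x) * (- x - r) = - ((1 + r * x) * (x - r))"
    by (simp add: xx)
  have "noise_kernel n r \<epsilon> (flip j \<eta>) * (\<epsilon> j * flip j \<eta> j - r) = ((1 + r * - x) * (- x - r)) * R"
    unfolding noise_kernel_split[OF j] R by (simp add: x_def mult_ac)
  also have "\<dots> = - (((1 + r * x) * R) * (x - r))" unfolding eq by (simp add: mult_ac)
  also have "\<dots> = - (noise_kernel n r \<epsilon> \<eta> * (\<epsilon> j * \<eta> j - r))"
    unfolding noise_kernel_split[OF j] R_def x_def ..
  finally show ?thesis .
qed

text \<open>The centred weight \<open>k\<^sub>r (\<epsilon>\<^sub>j \<eta>\<^sub>j - r)\<close> is odd in \<open>\<eta>\<^sub>j\<close>, so it annihilates the part of \<open>f\<close> that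
  is even in that coordinate and sees only \<open>D\<^sub>j f\<close>.\<close>

lemma expect_centered_discrete_deriv:
  assumes j: "j \<in> {1..n}" and \<epsilon>: "\<epsilon> \<in> cube n"
  shows "expect n (\<lambda>\<eta>. (noise_kernel n r \<epsilon> \<eta> * (\<epsilon> j * \<eta> j - r)) *\<^sub>R f \<eta>)
    = expect n (\<lambda>\<eta>. (noise_kernel n r \<epsilon> \<eta> * (\<epsilon> j * \<eta> j - r)) *\<^sub>R discrete_deriv j f \<eta>)"
proof -
  define w where "w = (\<lambda>\<eta>. noise_kernel n r \<epsilon> \<eta> * (\<epsilon> j * \<eta> j - r))"
  have "expect n (\<lambda>\<eta>. w \<eta> *\<^sub>R f (flip j \<eta>)) = expect n (\<lambda>\<eta>. w (flip j \<eta>) *\<^sub>R f \<eta>)"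
    using expect_flip[OF j, of "\<lambda>\<eta>. w (flip j \<eta>) *\<^sub>R f \<eta>"] by simp
  also have "\<dots> = expect n (\<lambda>\<eta>. (-1) *\<^sub>R (w \<eta> *\<^sub>R f \<eta>))"
    using noise_kernel_flip_cancel[OF j \<epsilon>] by (intro expect_cong) (simp add: w_def)
  also have "\<dots> = - expect n (\<lambda>\<eta>. w \<eta> *\<^sub>R f \<eta>)"
    unfolding expect_scaleR by simp
  finally have "expect n (\<lambda>\<eta>. (1 / 2) *\<^sub>R (w \<eta> *\<^sub>R f \<eta> - w \<eta> *\<^sub>R f (flip j \<eta>)))
      = expect n (\<lambda>\<eta>. w \<eta> *\<^sub>R f \<eta>)"
    unfolding expect_scaleR expect_diff by simp
  moreover have "(1 / 2) *\<^sub>R (w \<eta> *\<^sub>R f \<eta> - w \<eta> *\<^sub>R f (flip j \<eta>)) = w \<eta> *\<^sub>R discrete_deriv j f \<eta>" for \<eta>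
    by (simp add: discrete_deriv_def scaleR_diff_right)
  ultimately show ?thesis by (simp add: w_def)
qed

text \<open>Under the density \<open>k\<^sub>r(\<cdot>, \<eta>)\<close> the sign \<open>\<epsilon>\<^sub>j \<eta>\<^sub>j\<close> has mean \<open>r\<close>: a constant has vanishing
  discrete derivative.\<close>

lemma expect_noise_kernel_coord:
  assumes j: "j \<in> {1..n}" and \<eta>: "\<eta> \<in> cube n"
  shows "expect n (\<lambda>\<epsilon>. noise_kernel n r \<epsilon> \<eta> * (\<epsilon> j * \<eta> j)) = r"
proof -
  have "expect n (\<lambda>\<epsilon>. (noise_kernel n r \<eta> \<epsilon> * (\<eta> j * \<epsilon> j - r)) *\<^sub>R (1::real)) = 0"
    by (subst expect_centered_discrete_deriv[OF j \<eta>]) (simp add: discrete_deriv_def)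
  moreover have "(noise_kernel n r \<eta> \<epsilon> * (\<eta> j * \<epsilon> j - r)) *\<^sub>R (1::real)
      = noise_kernel n r \<epsilon> \<eta> * (\<epsilon> j * \<eta> j) - r * noise_kernel n r \<epsilon> \<eta>" for \<epsilon>
    by (simp add: noise_kernel_commute[of n r \<eta> \<epsilon>] algebra_simps)
  ultimately have "expect n (\<lambda>\<epsilon>. noise_kernel n r \<epsilon> \<eta> * (\<epsilon> j * \<eta> j) - r * noise_kernel n r \<epsilon> \<eta>) = 0"
    by (simp only:)
  then show ?thesis by (simp add: expect_diff expect_mult expect_noise_kernel')
qed

text \<open>The derivative of the kernel in \<open>r\<close>, kept as a polynomial so that it is also available, and
  continuous, at \<open>r = 1\<close>, where factors of the kernel vanish.\<close>

definition noise_kernel_deriv ::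
    "nat \<Rightarrow> real \<Rightarrow> (nat \<Rightarrow> real) \<Rightarrow> (nat \<Rightarrow> real) \<Rightarrow> real"
  where "noise_kernel_deriv n r \<epsilon> \<eta> =
    (\<Sum>j = 1..n. \<epsilon> j * \<eta> j * (\<Prod>i\<in>{1..n} - {j}. 1 + r * \<epsilon> i * \<eta> i))"

definition noise_deriv ::
    "nat \<Rightarrow> real \<Rightarrow> ((nat \<Rightarrow> real) \<Rightarrow> 'a::real_vector) \<Rightarrow> (nat \<Rightarrow> real) \<Rightarrow> 'a"
  where "noise_deriv n r f \<epsilon> = expect n (\<lambda>\<eta>. noise_kernel_deriv n r \<epsilon> \<eta> *\<^sub>R f \<eta>)"

lemma has_real_derivative_noise_kernel:
  "((\<lambda>r. noise_kernel n r \<epsilon> \<eta>) has_real_derivative noise_kernel_deriv n r \<epsilon> \<eta>) (at r)"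
  unfolding noise_kernel_def noise_kernel_deriv_def
  by (rule has_field_derivative_prod) (auto intro!: derivative_eq_intros)

lemma has_vector_derivative_noise:
  fixes f :: "(nat \<Rightarrow> real) \<Rightarrow> 'a::real_normed_vector"
  shows "((\<lambda>r. noise n r f \<epsilon>) has_vector_derivative noise_deriv n r f \<epsilon>) (at r)"
  unfolding noise_def noise_deriv_def expect_def
  by (auto intro!: derivative_eq_intros has_real_derivative_noise_kernel)

text \<open>The logarithmic derivative of the factor \<open>1 + r x\<close> with \<open>x\<^sup>2 = 1\<close> is
  \<open>x / (1 + r x) = (x - r) / (1 - r\<^sup>2)\<close>, which brings in the centred signs.\<close>

lemma noise_kernel_deriv_centered:
  assumes \<epsilon>: "\<epsilon> \<in> cube n" and \<eta>: "\<eta> \<in> cube n"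
  shows "(1 - r\<^sup>2) * noise_kernel_deriv n r \<epsilon> \<eta> = (\<Sum>j = 1..n. noise_kernel n r \<epsilon> \<eta> * (\<epsilon> j * \<eta> j - r))"
  unfolding noise_kernel_deriv_def sum_distrib_left
proof (intro sum.cong refl)
  fix j assume j: "j \<in> {1..n}"
  define x where "x = \<epsilon> j * \<eta> j"
  have xx: "x * x = 1"
    using cube_coord_sq[OF \<epsilon> j] cube_coord_sq[OF \<eta> j] by (simp add: x_def mult_ac)
  have "(1 + r * x) * (x - r) = (1 - r\<^sup>2) * x + r * (x * x - 1)"
    by (simp add: algebra_simps power2_eq_square)
  then have "(1 - r\<^sup>2) * x = (1 + r * x) * (x - r)" by (simp add: xx)
  then show "(1 - r\<^sup>2) * (\<epsilon> j * \<eta> j * (\<Prod>i\<in>{1..n} - {j}. 1 + r * \<epsilon> i * \<eta> i)) =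
      noise_kernel n r \<epsilon> \<eta> * (\<epsilon> j * \<eta> j - r)"
    unfolding noise_kernel_split[OF j] x_def[symmetric] by (simp add: mult_ac)
qed

text \<open>Both sides are the derivative in \<open>r\<close> of the semigroup law.\<close>

lemma noise_kernel_deriv_compose:
  "expect n (\<lambda>\<eta>. noise_kernel_deriv n r \<epsilon> \<eta> * noise_kernel n s \<eta> \<zeta>)
    = s * noise_kernel_deriv n (r * s) \<epsilon> \<zeta>"
proof (rule DERIV_unique)
  show "((\<lambda>r. noise_kernel n (r * s) \<epsilon> \<zeta>) has_real_derivative
      expect n (\<lambda>\<eta>. noise_kernel_deriv n r \<epsilon> \<eta> * noise_kernel n s \<eta> \<zeta>)) (at r)"
    unfolding noise_kernel_compose[symmetric] expect_def real_scaleR_def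
    by (intro DERIV_cmult DERIV_sum DERIV_cmult_right has_real_derivative_noise_kernel)
  show "((\<lambda>r. noise_kernel n (r * s) \<epsilon> \<zeta>) has_real_derivative
      s * noise_kernel_deriv n (r * s) \<epsilon> \<zeta>) (at r)"
    using DERIV_chain2[where f = "\<lambda>r. noise_kernel n r \<epsilon> \<zeta>" and g = "\<lambda>r. r * s" and x = r and s = UNIV,
        OF has_real_derivative_noise_kernel DERIV_cmult_right[OF DERIV_ident]]
    by (simp add: mult.commute)
qed

lemma noise_deriv_compose:
  "s *\<^sub>R noise_deriv n (r * s) f \<epsilon> = expect n (\<lambda>\<eta>. noise_kernel_deriv n r \<epsilon> \<eta> *\<^sub>R noise n s f \<eta>)"
proof -
  have "s *\<^sub>R noise_deriv n (r * s) f \<epsilon>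
      = expect n (\<lambda>\<zeta>. expect n (\<lambda>\<eta>. noise_kernel_deriv n r \<epsilon> \<eta> * noise_kernel n s \<eta> \<zeta>) *\<^sub>R f \<zeta>)"
    unfolding noise_kernel_deriv_compose noise_deriv_def by (simp add: expect_scaleR[symmetric])
  also have "\<dots> = expect n (\<lambda>\<eta>. expect n (\<lambda>\<zeta>. (noise_kernel_deriv n r \<epsilon> \<eta> * noise_kernel n s \<eta> \<zeta>) *\<^sub>R f \<zeta>))"
    unfolding expect_scaleR_left[symmetric] by (rule expect_swap)
  also have "\<dots> = expect n (\<lambda>\<eta>. noise_kernel_deriv n r \<epsilon> \<eta> *\<^sub>R noise n s f \<eta>)"
    unfolding noise_def expect_scaleR[symmetric] by simp
  finally show ?thesis .
qed

lemma noise_at_0: "noise n 0 f \<epsilon> = expect n f"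
  by (simp add: noise_def)

text \<open>At \<open>r = 1\<close> the kernel is \<open>2\<^sup>n\<close> on the diagonal of the cube and vanishes off it.\<close>

lemma noise_at_1:
  assumes \<epsilon>: "\<epsilon> \<in> cube n"
  shows "noise n 1 f \<epsilon> = f \<epsilon>"
proof -
  have zero: "noise_kernel n 1 \<epsilon> \<eta> = 0" if \<eta>: "\<eta> \<in> cube n - {\<epsilon>}" for \<eta>
  proof -
    obtain i where i: "i \<in> {1..n}" "\<epsilon> i \<noteq> \<eta> i"
      using PiE_ext[of \<epsilon> "{1..n}" "\<lambda>_. {-1, 1}" \<eta>] \<epsilon> \<eta> unfolding cube_def by blast
    then have "1 + 1 * \<epsilon> i * \<eta> i = 0"
      using cube_coord[OF \<epsilon> i(1)] cube_coord[of \<eta> n i] \<eta> by auto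
    then show ?thesis unfolding noise_kernel_def using i(1) by (intro prod_zero) auto
  qed
  have "noise_kernel n 1 \<epsilon> \<epsilon> = (\<Prod>i = 1..n. 2)"
    unfolding noise_kernel_def using cube_coord_sq[OF \<epsilon>] by (intro prod.cong) auto
  then have "(\<Sum>\<eta>\<in>cube n. noise_kernel n 1 \<epsilon> \<eta> *\<^sub>R f \<eta>) = 2 ^ n *\<^sub>R f \<epsilon>"
    using zero by (simp add: sum.remove[OF finite_cube \<epsilon>])
  then show ?thesis by (simp add: noise_def expect_def card_cube)
qed

section \<open>Biased signs in a space of type 2\<close>

definition exchange :: "(nat \<Rightarrow> real) \<Rightarrow> (nat \<Rightarrow> real) \<Rightarrow> (nat \<Rightarrow> real) \<Rightarrow> nat \<Rightarrow> real"
  where "exchange \<sigma> \<epsilon> \<epsilon>' = (\<lambda>i. if \<sigma> i = 1 then \<epsilon> i else \<epsilon>' i)"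

lemma exchange_in_cube: "\<epsilon> \<in> cube n \<Longrightarrow> \<epsilon>' \<in> cube n \<Longrightarrow> exchange \<sigma> \<epsilon> \<epsilon>' \<in> cube n"
  unfolding cube_def exchange_def by (auto simp: PiE_iff extensional_def)

lemma exchange_exchange: "exchange \<sigma> (exchange \<sigma> \<epsilon> \<epsilon>') (exchange \<sigma> \<epsilon>' \<epsilon>) = \<epsilon>"
  by (auto simp: exchange_def)

text \<open>Exchanging the coordinates of an independent pair on a set of indices, coded by the signs \<open>\<sigma>\<close>, is an
  involution of the product of two cubes.\<close>

lemma expect_exchange:
  "expect n (\<lambda>\<epsilon>. expect n (\<lambda>\<epsilon>'. \<Phi> (exchange \<sigma> \<epsilon> \<epsilon>') (exchange \<sigma> \<epsilon>' \<epsilon>)))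
    = expect n (\<lambda>\<epsilon>. expect n (\<lambda>\<epsilon>'. \<Phi> \<epsilon> \<epsilon>'))"
proof -
  have "(\<Sum>(\<epsilon>, \<epsilon>')\<in>cube n \<times> cube n. \<Phi> (exchange \<sigma> \<epsilon> \<epsilon>') (exchange \<sigma> \<epsilon>' \<epsilon>))
      = (\<Sum>(\<epsilon>, \<epsilon>')\<in>cube n \<times> cube n. \<Phi> \<epsilon> \<epsilon>')"
    by (rule sum.reindex_bij_witness[of _
          "\<lambda>(\<epsilon>, \<epsilon>'). (exchange \<sigma> \<epsilon> \<epsilon>', exchange \<sigma> \<epsilon>' \<epsilon>)"
          "\<lambda>(\<epsilon>, \<epsilon>'). (exchange \<sigma> \<epsilon> \<epsilon>', exchange \<sigma> \<epsilon>' \<epsilon>)"])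
       (auto simp: exchange_exchange exchange_in_cube)
  then show ?thesis
    unfolding expect_def scaleR_sum_right[symmetric] sum.cartesian_product by simp
qed

lemma noise_kernel_exchange:
  "noise_kernel n r (exchange \<sigma> \<epsilon> \<epsilon>') \<eta> * noise_kernel n r (exchange \<sigma> \<epsilon>' \<epsilon>) \<eta>
    = noise_kernel n r \<epsilon> \<eta> * noise_kernel n r \<epsilon>' \<eta>"
  unfolding noise_kernel_def prod.distrib[symmetric] exchange_def by (intro prod.cong) auto

lemma exchange_diff:
  assumes "\<sigma> \<in> cube n" "j \<in> {1..n}"
  shows "exchange \<sigma> \<epsilon> \<epsilon>' j - exchange \<sigma> \<epsilon>' \<epsilon> j = \<sigma> j * (\<epsilon> j - \<epsilon>' j)"
  using cube_coord[OF assms] by (auto simp: exchange_def)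

text \<open>Symmetrization: subtracting the mean \<open>r\<close> is averaging over an independent copy \<open>\<epsilon>'\<close>, which by
  Jensen may be moved outside the squared norm. The joint density of the pair is invariant under the
  exchange of any coordinates, which multiplies the differences \<open>\<epsilon>\<^sub>j - \<epsilon>'\<^sub>j\<close> by arbitrary signs;
  averaging over these signs, type 2 applies conditionally on the pair. The constant is the second
  moment \<open>2 (1 - r\<^sup>2)\<close> of \<open>\<epsilon>\<^sub>j - \<epsilon>'\<^sub>j\<close>.\<close>

lemma type2_biased_signs:
  fixes y :: "nat \<Rightarrow> 'a::real_normed_vector"
  assumes T: "type2_bound TYPE('a) T" and n: "1 \<le> n" and r: "\<bar>r\<bar> \<le> 1" and \<eta>: "\<eta> \<in> cube n"
  shows "expect n (\<lambda>\<epsilon>. noise_kernel n r \<epsilon> \<eta> * (norm (\<Sum>j = 1..n. (\<epsilon> j * \<eta> j - r) *\<^sub>R y j))\<^sup>2)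
    \<le> 2 * (1 - r\<^sup>2) * T\<^sup>2 * (\<Sum>j = 1..n. (norm (y j))\<^sup>2)"
proof -
  define K where "K = (\<lambda>\<epsilon>. noise_kernel n r \<epsilon> \<eta>)"
  define x where "x = (\<lambda>\<epsilon> \<epsilon>' j. ((\<epsilon> j - \<epsilon>' j) * \<eta> j) *\<^sub>R y j)"
  have K0: "0 \<le> K \<epsilon>" if "\<epsilon> \<in> cube n" for \<epsilon>
    unfolding K_def by (rule noise_kernel_nonneg[OF r that \<eta>])
  have K1: "expect n K = 1" unfolding K_def by (rule expect_noise_kernel')
  have Kj: "expect n (\<lambda>\<epsilon>. K \<epsilon> * (\<epsilon> j * \<eta> j)) = r" if "j \<in> {1..n}" for j
    unfolding K_def by (rule expect_noise_kernel_coord[OF that \<eta>])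
  have centre: "(\<Sum>j = 1..n. (\<epsilon> j * \<eta> j - r) *\<^sub>R y j)
      = expect n (\<lambda>\<epsilon>'. K \<epsilon>' *\<^sub>R (\<Sum>j = 1..n. x \<epsilon> \<epsilon>' j))" for \<epsilon>
  proof -
    have "expect n (\<lambda>\<epsilon>'. K \<epsilon>' *\<^sub>R (\<Sum>j = 1..n. x \<epsilon> \<epsilon>' j))
        = (\<Sum>j = 1..n. expect n (\<lambda>\<epsilon>'. (\<epsilon> j * \<eta> j * K \<epsilon>' - K \<epsilon>' * (\<epsilon>' j * \<eta> j)) *\<^sub>R y j))"
      unfolding scaleR_sum_right expect_sum x_def by (simp add: algebra_simps)
    also have "\<dots> = (\<Sum>j = 1..n. (\<epsilon> j * \<eta> j - r) *\<^sub>R y j)"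
      by (intro sum.cong refl) (simp add: expect_scaleR_left expect_diff expect_mult K1 Kj)
    finally show ?thesis by simp
  qed
  define S where "S = expect n (\<lambda>\<epsilon>. expect n (\<lambda>\<epsilon>'. K \<epsilon> * K \<epsilon>' * (norm (\<Sum>j = 1..n. x \<epsilon> \<epsilon>' j))\<^sup>2))"
  have "expect n (\<lambda>\<epsilon>. K \<epsilon> * (norm (\<Sum>j = 1..n. (\<epsilon> j * \<eta> j - r) *\<^sub>R y j))\<^sup>2) \<le> S"
    unfolding S_def
  proof (rule expect_mono)
    fix \<epsilon> assume e: "\<epsilon> \<in> cube n"
    have "K \<epsilon> * (norm (\<Sum>j = 1..n. (\<epsilon> j * \<eta> j - r) *\<^sub>R y j))\<^sup>2
        \<le> K \<epsilon> * expect n (\<lambda>\<epsilon>'. K \<epsilon>' * (norm (\<Sum>j = 1..n. x \<epsilon> \<epsilon>' j))\<^sup>2)"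
      unfolding centre by (intro mult_left_mono expect_norm_square_le K0 K1 e)
    then show "K \<epsilon> * (norm (\<Sum>j = 1..n. (\<epsilon> j * \<eta> j - r) *\<^sub>R y j))\<^sup>2
        \<le> expect n (\<lambda>\<epsilon>'. K \<epsilon> * K \<epsilon>' * (norm (\<Sum>j = 1..n. x \<epsilon> \<epsilon>' j))\<^sup>2)"
      by (simp add: expect_mult[symmetric] mult.assoc)
  qed
  also have "S = expect n (\<lambda>\<sigma>. expect n (\<lambda>\<epsilon>. expect n (\<lambda>\<epsilon>'.
      K \<epsilon> * K \<epsilon>' * (norm (\<Sum>j = 1..n. \<sigma> j *\<^sub>R x \<epsilon> \<epsilon>' j))\<^sup>2)))"
  proof -
    have "expect n (\<lambda>\<epsilon>. expect n (\<lambda>\<epsilon>'. K \<epsilon> * K \<epsilon>' * (norm (\<Sum>j = 1..n. \<sigma> j *\<^sub>R x \<epsilon> \<epsilon>' j))\<^sup>2)) = S"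
      if \<sigma>: "\<sigma> \<in> cube n" for \<sigma>
    proof -
      have "(\<Sum>j = 1..n. \<sigma> j *\<^sub>R x \<epsilon> \<epsilon>' j)
          = (\<Sum>j = 1..n. x (exchange \<sigma> \<epsilon> \<epsilon>') (exchange \<sigma> \<epsilon>' \<epsilon>) j)" for \<epsilon> \<epsilon>'
        unfolding x_def by (intro sum.cong refl) (simp add: exchange_diff[OF \<sigma>] mult.assoc)
      moreover have "K \<epsilon> * K \<epsilon>' = K (exchange \<sigma> \<epsilon> \<epsilon>') * K (exchange \<sigma> \<epsilon>' \<epsilon>)" for \<epsilon> \<epsilon>'
        unfolding K_def by (rule noise_kernel_exchange[symmetric])
      ultimately show ?thesis unfolding S_def
        using expect_exchange[of n "\<lambda>\<epsilon> \<epsilon>'. K \<epsilon> * K \<epsilon>' * (norm (\<Sum>j = 1..n. x \<epsilon> \<epsilon>' j))\<^sup>2" \<sigma>]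
        by simp
    qed
    then show ?thesis by (simp cong: expect_cong)
  qed
  also have "\<dots> = expect n (\<lambda>\<epsilon>. expect n (\<lambda>\<sigma>. expect n (\<lambda>\<epsilon>'.
      K \<epsilon> * K \<epsilon>' * (norm (\<Sum>j = 1..n. \<sigma> j *\<^sub>R x \<epsilon> \<epsilon>' j))\<^sup>2)))"
    by (rule expect_swap)
  also have "\<dots> = expect n (\<lambda>\<epsilon>. expect n (\<lambda>\<epsilon>'. expect n (\<lambda>\<sigma>.
      K \<epsilon> * K \<epsilon>' * (norm (\<Sum>j = 1..n. \<sigma> j *\<^sub>R x \<epsilon> \<epsilon>' j))\<^sup>2)))"
    by (intro expect_cong expect_swap)
  also have "\<dots> \<le> expect n (\<lambda>\<epsilon>. expect n (\<lambda>\<epsilon>'. K \<epsilon> * K \<epsilon>' * (T\<^sup>2 * (\<Sum>j = 1..n. (norm (x \<epsilon> \<epsilon>' j))\<^sup>2))))"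
    using T n unfolding type2_bound_def expect_mult
    by (intro expect_mono mult_left_mono mult_nonneg_nonneg K0) auto
  also have "\<dots> = expect n (\<lambda>\<epsilon>. expect n (\<lambda>\<epsilon>'. \<Sum>j = 1..n. T\<^sup>2 * (norm (y j))\<^sup>2 *
      (2 * K \<epsilon> * K \<epsilon>' - 2 * (K \<epsilon> * (\<epsilon> j * \<eta> j)) * (K \<epsilon>' * (\<epsilon>' j * \<eta> j)))))"
  proof (intro expect_cong)
    fix \<epsilon> \<epsilon>' assume e: "\<epsilon> \<in> cube n" "\<epsilon>' \<in> cube n"
    have "K \<epsilon> * K \<epsilon>' * (T\<^sup>2 * (norm (x \<epsilon> \<epsilon>' j))\<^sup>2) = T\<^sup>2 * (norm (y j))\<^sup>2 *
      (2 * K \<epsilon> * K \<epsilon>' - 2 * (K \<epsilon> * (\<epsilon> j * \<eta> j)) * (K \<epsilon>' * (\<epsilon>' j * \<eta> j)))" if j: "j \<in> {1..n}" for j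
    proof -
      have "(norm (x \<epsilon> \<epsilon>' j))\<^sup>2 = (2 - 2 * (\<epsilon> j * \<eta> j) * (\<epsilon>' j * \<eta> j)) * (norm (y j))\<^sup>2"
        using cube_coord[OF e(1) j] cube_coord[OF e(2) j] cube_coord[OF \<eta> j]
        by (auto simp: x_def power_mult_distrib)
      show ?thesis unfolding \<open>(norm (x \<epsilon> \<epsilon>' j))\<^sup>2 = _\<close> by (simp add: algebra_simps)
    qed
    then show "K \<epsilon> * K \<epsilon>' * (T\<^sup>2 * (\<Sum>j = 1..n. (norm (x \<epsilon> \<epsilon>' j))\<^sup>2)) = (\<Sum>j = 1..n. T\<^sup>2 * (norm (y j))\<^sup>2 *
      (2 * K \<epsilon> * K \<epsilon>' - 2 * (K \<epsilon> * (\<epsilon> j * \<eta> j)) * (K \<epsilon>' * (\<epsilon>' j * \<eta> j))))"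
      unfolding sum_distrib_left by (intro sum.cong) auto
  qed
  also have "\<dots> = (\<Sum>j = 1..n. T\<^sup>2 * (norm (y j))\<^sup>2 * (2 - 2 * r * r))"
  proof -
    have "expect n (\<lambda>\<epsilon>. expect n (\<lambda>\<epsilon>'. 2 * K \<epsilon> * K \<epsilon>' - 2 * (K \<epsilon> * (\<epsilon> j * \<eta> j)) * (K \<epsilon>' * (\<epsilon>' j * \<eta> j))))
        = 2 - 2 * r * r" if j: "j \<in> {1..n}" for j
    proof -
      have "expect n (\<lambda>\<epsilon>. expect n (\<lambda>\<epsilon>'. 2 * K \<epsilon> * K \<epsilon>' - 2 * (K \<epsilon> * (\<epsilon> j * \<eta> j)) * (K \<epsilon>' * (\<epsilon>' j * \<eta> j))))
        = expect n (\<lambda>\<epsilon>. 2 * K \<epsilon> - (2 * r) * (K \<epsilon> * (\<epsilon> j * \<eta> j)))"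
      proof (rule expect_cong)
        fix \<epsilon>
        show "expect n (\<lambda>\<epsilon>'. 2 * K \<epsilon> * K \<epsilon>' - 2 * (K \<epsilon> * (\<epsilon> j * \<eta> j)) * (K \<epsilon>' * (\<epsilon>' j * \<eta> j)))
          = 2 * K \<epsilon> - (2 * r) * (K \<epsilon> * (\<epsilon> j * \<eta> j))"
          unfolding expect_diff expect_mult K1 Kj[OF j] by simp
      qed
      then show ?thesis unfolding expect_diff expect_mult K1 Kj[OF j] by simp
    qed
    then show ?thesis by (simp only: expect_sum expect_mult cong: sum.cong)
  qed
  also have "\<dots> = 2 * (1 - r\<^sup>2) * T\<^sup>2 * (\<Sum>j = 1..n. (norm (y j))\<^sup>2)"
    unfolding sum_distrib_left by (intro sum.cong refl) (simp add: power2_eq_square algebra_simps)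
  finally show ?thesis unfolding K_def .
qed

text \<open>By the semigroup law \<open>r\<close> times the derivative at \<open>r\<^sup>2\<close> is the derivative of the kernel at \<open>r\<close>
  applied to \<open>T\<^sub>r f\<close>. Writing that kernel through the centred signs, Jensen in \<open>\<eta>\<close> reduces the
  claim to a fixed \<open>\<eta>\<close>, where the signs are those of a biased random sum.\<close>

lemma noise_deriv_bound:
  fixes f :: "(nat \<Rightarrow> real) \<Rightarrow> 'a::real_normed_vector"
  assumes T: "type2_bound TYPE('a) T" and n: "1 \<le> n" and r: "\<bar>r\<bar> < 1"
  shows "r\<^sup>2 * (1 - r\<^sup>2) * expect n (\<lambda>\<epsilon>. (norm (noise_deriv n (r\<^sup>2) f \<epsilon>))\<^sup>2)
    \<le> 2 * T\<^sup>2 * (\<Sum>j = 1..n. expect n (\<lambda>\<epsilon>. (norm (noise n r (discrete_deriv j f) \<epsilon>))\<^sup>2))"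
proof -
  define g where "g = noise n r f"
  have pos: "0 < 1 - r\<^sup>2" using r by (simp add: abs_square_less_1)
  have rep: "((1 - r\<^sup>2) * r) *\<^sub>R noise_deriv n (r\<^sup>2) f \<epsilon> = expect n (\<lambda>\<eta>. noise_kernel n r \<epsilon> \<eta> *\<^sub>R
      (\<Sum>j = 1..n. (\<epsilon> j * \<eta> j - r) *\<^sub>R discrete_deriv j g \<eta>))" if e: "\<epsilon> \<in> cube n" for \<epsilon>
  proof -
    have "((1 - r\<^sup>2) * r) *\<^sub>R noise_deriv n (r\<^sup>2) f \<epsilon>
        = expect n (\<lambda>\<eta>. ((1 - r\<^sup>2) * noise_kernel_deriv n r \<epsilon> \<eta>) *\<^sub>R g \<eta>)"
      unfolding g_def power2_eq_square[of r]
      by (simp add: noise_deriv_compose scaleR_scaleR[symmetric] expect_scaleR del: scaleR_scaleR)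
    also have "\<dots> = expect n (\<lambda>\<eta>. \<Sum>j = 1..n. (noise_kernel n r \<epsilon> \<eta> * (\<epsilon> j * \<eta> j - r)) *\<^sub>R g \<eta>)"
      by (intro expect_cong) (simp add: noise_kernel_deriv_centered[OF e] scaleR_sum_left)
    also have "\<dots> = (\<Sum>j = 1..n. expect n (\<lambda>\<eta>. (noise_kernel n r \<epsilon> \<eta> * (\<epsilon> j * \<eta> j - r)) *\<^sub>R discrete_deriv j g \<eta>))"
      unfolding expect_sum by (intro sum.cong refl expect_centered_discrete_deriv e)
    also have "\<dots> = expect n (\<lambda>\<eta>. noise_kernel n r \<epsilon> \<eta> *\<^sub>R
      (\<Sum>j = 1..n. (\<epsilon> j * \<eta> j - r) *\<^sub>R discrete_deriv j g \<eta>))"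
      unfolding expect_sum[symmetric] scaleR_sum_right by simp
    finally show ?thesis .
  qed
  have "((1 - r\<^sup>2) * r)\<^sup>2 * expect n (\<lambda>\<epsilon>. (norm (noise_deriv n (r\<^sup>2) f \<epsilon>))\<^sup>2)
      = expect n (\<lambda>\<epsilon>. (norm (((1 - r\<^sup>2) * r) *\<^sub>R noise_deriv n (r\<^sup>2) f \<epsilon>))\<^sup>2)"
    unfolding expect_mult[symmetric] norm_scaleR power_mult_distrib power2_abs ..
  also have "\<dots> \<le> expect n (\<lambda>\<epsilon>. expect n (\<lambda>\<eta>. noise_kernel n r \<epsilon> \<eta> *
      (norm (\<Sum>j = 1..n. (\<epsilon> j * \<eta> j - r) *\<^sub>R discrete_deriv j g \<eta>))\<^sup>2))"
  proof (rule expect_mono)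
    fix \<epsilon> assume e: "\<epsilon> \<in> cube n"
    show "(norm (((1 - r\<^sup>2) * r) *\<^sub>R noise_deriv n (r\<^sup>2) f \<epsilon>))\<^sup>2 \<le> expect n (\<lambda>\<eta>. noise_kernel n r \<epsilon> \<eta> *
      (norm (\<Sum>j = 1..n. (\<epsilon> j * \<eta> j - r) *\<^sub>R discrete_deriv j g \<eta>))\<^sup>2)"
      unfolding rep[OF e] using r
      by (intro expect_norm_square_le noise_kernel_nonneg e expect_noise_kernel) auto
  qed
  also have "\<dots> = expect n (\<lambda>\<eta>. expect n (\<lambda>\<epsilon>. noise_kernel n r \<epsilon> \<eta> *
      (norm (\<Sum>j = 1..n. (\<epsilon> j * \<eta> j - r) *\<^sub>R discrete_deriv j g \<eta>))\<^sup>2))"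
    by (rule expect_swap)
  also have "\<dots> \<le> expect n (\<lambda>\<eta>. 2 * (1 - r\<^sup>2) * T\<^sup>2 * (\<Sum>j = 1..n. (norm (discrete_deriv j g \<eta>))\<^sup>2))"
    using r by (intro expect_mono type2_biased_signs T n) auto
  also have "\<dots> = (1 - r\<^sup>2) * (2 * T\<^sup>2 * (\<Sum>j = 1..n. expect n (\<lambda>\<eta>. (norm (discrete_deriv j g \<eta>))\<^sup>2)))"
    unfolding expect_mult expect_sum by simp
  also have "(\<Sum>j = 1..n. expect n (\<lambda>\<eta>. (norm (discrete_deriv j g \<eta>))\<^sup>2))
      = (\<Sum>j = 1..n. expect n (\<lambda>\<epsilon>. (norm (noise n r (discrete_deriv j f) \<epsilon>))\<^sup>2))"
    unfolding g_def by (intro sum.cong refl) (simp add: discrete_deriv_noise)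
  finally have le: "((1 - r\<^sup>2) * r)\<^sup>2 * expect n (\<lambda>\<epsilon>. (norm (noise_deriv n (r\<^sup>2) f \<epsilon>))\<^sup>2)
    \<le> (1 - r\<^sup>2) * (2 * T\<^sup>2 * (\<Sum>j = 1..n. expect n (\<lambda>\<epsilon>. (norm (noise n r (discrete_deriv j f) \<epsilon>))\<^sup>2)))" .
  have "(1 - r\<^sup>2) * (r\<^sup>2 * (1 - r\<^sup>2) * expect n (\<lambda>\<epsilon>. (norm (noise_deriv n (r\<^sup>2) f \<epsilon>))\<^sup>2))
    \<le> (1 - r\<^sup>2) * (2 * T\<^sup>2 * (\<Sum>j = 1..n. expect n (\<lambda>\<epsilon>. (norm (noise n r (discrete_deriv j f) \<epsilon>))\<^sup>2)))"
  proof -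
    have *: "((1 - r\<^sup>2) * r)\<^sup>2 * X = (1 - r\<^sup>2) * (r\<^sup>2 * (1 - r\<^sup>2) * X)" for X
      by (simp add: power2_eq_square)
    show ?thesis using le unfolding * .
  qed
  then show ?thesis using pos by (simp only: mult_le_cancel_left_pos)
qed

section \<open>Integrating along the path against a weight adapted to h\<close>

text \<open>The superposition over \<open>s \<ge> 1\<close> of the profiles \<open>u \<mapsto> 1 / (1 + s u\<^sup>2)\<close>, which live on the scale
  \<open>u \<approx> 1 / \<surd>s\<close> at which \<open>exp(- s u\<^sup>2)\<close> decays. Their mass in \<open>u\<close> is of order \<open>1 / \<surd>s\<close>, so the
  factor \<open>1 / (s \<surd>s)\<close> makes the total mass comparable to the integral of \<open>h(s) / s\<^sup>2\<close>.\<close>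

definition path_weight :: "(real \<Rightarrow> real) \<Rightarrow> real \<Rightarrow> ennreal"
  where "path_weight h u =
    (\<integral>\<^sup>+s\<in>{1..}. ennreal (h s / (s * sqrt s * (1 + s * u\<^sup>2))) \<partial>lborel)"

lemma borel_measurable_path_weight:
  assumes "mono h"
  shows "path_weight h \<in> borel_measurable borel"
proof -
  have [measurable]: "h \<in> borel_measurable borel" using assms by (rule borel_measurable_mono)
  show ?thesis unfolding path_weight_def by measurable
qed

lemma nn_integral_inverse_quadratic_le:
  assumes s: "0 < s"
  shows "(\<integral>\<^sup>+u\<in>{0..1}. ennreal (1 / (1 + s * u\<^sup>2)) \<partial>lborel) \<le> ennreal (pi / 2 / sqrt s)"
proof -
  have pos: "0 < 1 + s * u\<^sup>2" for u :: real
    using s by (intro add_pos_nonneg) auto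
  have "(\<integral>\<^sup>+u\<in>{0..1}. ennreal (1 / (1 + s * u\<^sup>2)) \<partial>lborel)
      = ennreal (arctan (sqrt s * 1) / sqrt s - arctan (sqrt s * 0) / sqrt s)"
  proof (rule nn_integral_FTC_Icc)
    fix u :: real assume "u \<in> {0..1}"
    have "((\<lambda>u. arctan (sqrt s * u) / sqrt s) has_real_derivative
        (inverse (1 + (sqrt s * u)\<^sup>2) * sqrt s) / sqrt s) (at u)"
      using s by (auto intro!: derivative_eq_intros simp: divide_simps)
    then show "((\<lambda>u. arctan (sqrt s * u) / sqrt s) has_real_derivative 1 / (1 + s * u\<^sup>2)) (at u)"
      using s by (simp add: power_mult_distrib inverse_eq_divide)
    show "0 \<le> 1 / (1 + s * u\<^sup>2)" using pos[of u] by simp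
  qed auto
  also have "\<dots> \<le> ennreal (pi / 2 / sqrt s)"
    using s arctan_ubound[of "sqrt s"]
    by (intro ennreal_leI) (simp add: divide_right_mono del: divide_divide_eq_left)
  finally show ?thesis .
qed

lemma nn_integral_path_weight_le:
  assumes h: "mono h" "\<And>t. 0 \<le> h t"
  shows "(\<integral>\<^sup>+u\<in>{0..1}. path_weight h u \<partial>lborel)
    \<le> ennreal (pi / 2) * (\<integral>\<^sup>+s\<in>{1..}. ennreal (h s / s\<^sup>2) \<partial>lborel)"
proof -
  have [measurable]: "h \<in> borel_measurable borel" using h(1) by (rule borel_measurable_mono)
  have "(\<integral>\<^sup>+u\<in>{0..1}. path_weight h u \<partial>lborel)
      = (\<integral>\<^sup>+u. (\<integral>\<^sup>+s. ennreal (h s / (s * sqrt s * (1 + s * u\<^sup>2))) * indicator {1..} s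
          * indicator {0..1} u \<partial>lborel) \<partial>lborel)"
    unfolding path_weight_def by (intro nn_integral_cong nn_integral_multc[symmetric]) measurable
  also have "\<dots> = (\<integral>\<^sup>+s. (\<integral>\<^sup>+u. ennreal (h s / (s * sqrt s * (1 + s * u\<^sup>2))) * indicator {1..} s
          * indicator {0..1} u \<partial>lborel) \<partial>lborel)"
    by (rule lborel_pair.Fubini') measurable
  also have "\<dots> \<le> (\<integral>\<^sup>+s. ennreal (pi / 2) * (ennreal (h s / s\<^sup>2) * indicator {1..} s) \<partial>lborel)"
  proof (rule nn_integral_mono)
    fix s :: real
    show "(\<integral>\<^sup>+u. ennreal (h s / (s * sqrt s * (1 + s * u\<^sup>2))) * indicator {1..} s
          * indicator {0..1} u \<partial>lborel) \<le> ennreal (pi / 2) * (ennreal (h s / s\<^sup>2) * indicator {1..} s)"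
    proof (cases "1 \<le> s")
      case True
      have "(\<integral>\<^sup>+u. ennreal (h s / (s * sqrt s * (1 + s * u\<^sup>2))) * indicator {1..} s
          * indicator {0..1} u \<partial>lborel)
        = (\<integral>\<^sup>+u. ennreal (h s / (s * sqrt s)) * (ennreal (1 / (1 + s * u\<^sup>2)) * indicator {0..1} u) \<partial>lborel)"
        using True h(2)[of s]
        by (intro nn_integral_cong) (simp add: mult.assoc[symmetric] ennreal_mult[symmetric])
      also have "\<dots> = ennreal (h s / (s * sqrt s)) * (\<integral>\<^sup>+u\<in>{0..1}. ennreal (1 / (1 + s * u\<^sup>2)) \<partial>lborel)"
        by (rule nn_integral_cmult) measurable
      also have "\<dots> \<le> ennreal (h s / (s * sqrt s)) * ennreal (pi / 2 / sqrt s)"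
        using True by (intro mult_left_mono nn_integral_inverse_quadratic_le) auto
      also have "\<dots> = ennreal (pi / 2 * (h s / s\<^sup>2))"
      proof -
        have "c / (q\<^sup>2 * q) * (pi / 2 / q) = pi / 2 * (c / (q\<^sup>2)\<^sup>2)" for c q :: real
          by (simp add: power2_eq_square mult_ac)
        from this[of "h s" "sqrt s"]
        have "h s / (s * sqrt s) * (pi / 2 / sqrt s) = pi / 2 * (h s / s\<^sup>2)"
          using True by simp
        then show ?thesis using True h(2)[of s] by (subst ennreal_mult[symmetric]) auto
      qed
      also have "\<dots> = ennreal (pi / 2) * (ennreal (h s / s\<^sup>2) * indicator {1..} s)"
        using True h(2)[of s] by (simp add: ennreal_mult[symmetric] del: ennreal_mult)
      finally show ?thesis .
    qed simp
  qed
  also have "\<dots> = ennreal (pi / 2) * (\<integral>\<^sup>+s\<in>{1..}. ennreal (h s / s\<^sup>2) \<partial>lborel)"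
    by (rule nn_integral_cmult) measurable
  finally show ?thesis .
qed

lemma path_weight_finite:
  assumes h: "mono h" "\<And>t. 0 \<le> h t" and fin: "(\<integral>\<^sup>+s\<in>{1..}. ennreal (h s / s\<^sup>2) \<partial>lborel) < \<infinity>"
    and u: "u \<noteq> 0"
  shows "path_weight h u < \<infinity>"
proof -
  have [measurable]: "h \<in> borel_measurable borel" using h(1) by (rule borel_measurable_mono)
  have "path_weight h u \<le> (\<integral>\<^sup>+s. ennreal (1 / u\<^sup>2) * (ennreal (h s / s\<^sup>2) * indicator {1..} s) \<partial>lborel)"
    unfolding path_weight_def
  proof (rule nn_integral_mono)
    fix s :: real
    show "ennreal (h s / (s * sqrt s * (1 + s * u\<^sup>2))) * indicator {1..} s
      \<le> ennreal (1 / u\<^sup>2) * (ennreal (h s / s\<^sup>2) * indicator {1..} s)"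
    proof (cases "1 \<le> s")
      case True
      have "s * 1 * (s * u\<^sup>2) \<le> s * sqrt s * (1 + s * u\<^sup>2)"
        using True by (intro mult_mono) auto
      then have "h s / (s * sqrt s * (1 + s * u\<^sup>2)) \<le> h s / (s * 1 * (s * u\<^sup>2))"
        using True u h(2)[of s] by (intro divide_left_mono) (auto intro!: mult_pos_pos add_pos_nonneg)
      also have "\<dots> = 1 / u\<^sup>2 * (h s / s\<^sup>2)" by (simp add: power2_eq_square)
      finally show ?thesis using True h(2)[of s]
        by (simp add: ennreal_mult[symmetric] ennreal_leI del: ennreal_mult)
    qed simp
  qed
  also have "\<dots> = ennreal (1 / u\<^sup>2) * (\<integral>\<^sup>+s\<in>{1..}. ennreal (h s / s\<^sup>2) \<partial>lborel)"
    by (rule nn_integral_cmult) measurable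
  also have "\<dots> < \<infinity>" using fin by (simp add: ennreal_mult_less_top)
  finally show ?thesis .
qed

lemma nn_integral_tail:
  assumes M: "0 < M"
  shows "(\<integral>\<^sup>+s\<in>{M..}. ennreal (1 / (s\<^sup>2 * sqrt s)) \<partial>lborel) = ennreal (2 / (3 * (M * sqrt M)))"
proof -
  have "(\<integral>\<^sup>+s\<in>{M..}. ennreal (1 / (s\<^sup>2 * sqrt s)) \<partial>lborel)
      = ennreal (0 - (- 2 / 3 * (1 / (M * sqrt M))))"
  proof (rule nn_integral_FTC_atLeast)
    fix s assume "M \<le> s"
    then have s: "0 < s" using M by simp
    have "((\<lambda>s. - 2 / 3 * (1 / (s * sqrt s))) has_real_derivative
        - 2 / 3 * (- (sqrt s + s * (inverse (sqrt s) / 2)) / (s * sqrt s)\<^sup>2)) (at s)"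
      using s by (auto intro!: derivative_eq_intros simp: field_simps power2_eq_square)
    moreover have "- 2 / 3 * (- (sqrt s + s * (inverse (sqrt s) / 2)) / (s * sqrt s)\<^sup>2) = 1 / (s\<^sup>2 * sqrt s)"
    proof -
      have "s * inverse (sqrt s) = sqrt s" using s by (simp add: divide_inverse[symmetric] real_div_sqrt)
      then have "sqrt s + s * (inverse (sqrt s) / 2) = 3 / 2 * sqrt s" by simp
      moreover have "(s * sqrt s)\<^sup>2 = s\<^sup>2 * sqrt s * sqrt s" using s by (simp add: power2_eq_square)
      ultimately show ?thesis using s by simp
    qed
    ultimately show "((\<lambda>s. - 2 / 3 * (1 / (s * sqrt s))) has_real_derivative 1 / (s\<^sup>2 * sqrt s)) (at s)"
      by simp
    show "0 \<le> 1 / (s\<^sup>2 * sqrt s)" using s by simp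
  next
    have "filterlim (\<lambda>s. s * sqrt s) at_top at_top"
      by (intro filterlim_at_top_mult_at_top filterlim_ident sqrt_at_top)
    then have "((\<lambda>s. 1 / (s * sqrt s)) \<longlongrightarrow> 0) at_top"
      by (intro tendsto_divide_0[OF tendsto_const] filterlim_at_top_imp_at_infinity)
    then have "((\<lambda>s. - 2 / 3 * (1 / (s * sqrt s))) \<longlongrightarrow> - 2 / 3 * 0) at_top"
      by (intro tendsto_mult tendsto_const)
    then show "((\<lambda>s. - 2 / 3 * (1 / (s * sqrt s))) \<longlongrightarrow> 0) at_top" by simp
  qed measurable
  then show ?thesis using M by simp
qed

text \<open>Only the part \<open>s \<ge> M\<close> of the integral is kept; there \<open>h s \<ge> h M\<close> and
  \<open>1 + s u\<^sup>2 \<le> (s / M) (1 + M u\<^sup>2)\<close>, which leaves the tail integral of \<open>1 / (s\<^sup>2 \<surd>s)\<close>.\<close>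

lemma path_weight_ge:
  assumes h: "mono h" "\<And>t. 0 \<le> h t" and M: "1 \<le> M"
  shows "ennreal (2 * h M / (3 * sqrt M * (1 + M * u\<^sup>2))) \<le> path_weight h u"
proof -
  define c where "c = h M * M / (1 + M * u\<^sup>2)"
  have pos: "0 < 1 + M * u\<^sup>2" using M by (intro add_pos_nonneg) auto
  have c: "0 \<le> c" using M h(2)[of M] pos by (simp add: c_def)
  have "ennreal (2 * h M / (3 * sqrt M * (1 + M * u\<^sup>2))) = ennreal c * ennreal (2 / (3 * (M * sqrt M)))"
    using M c by (simp add: ennreal_mult[symmetric] c_def field_simps del: ennreal_mult)
  also have "\<dots> = ennreal c * (\<integral>\<^sup>+s\<in>{M..}. ennreal (1 / (s\<^sup>2 * sqrt s)) \<partial>lborel)"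
    using M by (simp add: nn_integral_tail)
  also have "\<dots> = (\<integral>\<^sup>+s. ennreal c * (ennreal (1 / (s\<^sup>2 * sqrt s)) * indicator {M..} s) \<partial>lborel)"
    by (rule nn_integral_cmult[symmetric]) measurable
  also have "\<dots> \<le> path_weight h u"
    unfolding path_weight_def
  proof (rule nn_integral_mono)
    fix s :: real
    show "ennreal c * (ennreal (1 / (s\<^sup>2 * sqrt s)) * indicator {M..} s)
      \<le> ennreal (h s / (s * sqrt s * (1 + s * u\<^sup>2))) * indicator {1..} s"
    proof (cases "M \<le> s")
      case True
      then have s: "1 \<le> s" using M by simp
      have "M * 1 \<le> s * 1" using True by simp
      then have "M * (1 + s * u\<^sup>2) \<le> s * (1 + M * u\<^sup>2)" by (simp add: algebra_simps)
      then have le: "M / (1 + M * u\<^sup>2) * (1 / s) \<le> 1 / (1 + s * u\<^sup>2)"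
        using pos s by (simp add: divide_simps add_pos_nonneg mult_ac)
      have "c * (1 / (s\<^sup>2 * sqrt s)) = h M * (1 / (s * sqrt s)) * (M / (1 + M * u\<^sup>2) * (1 / s))"
        by (simp add: c_def power2_eq_square)
      also have "\<dots> \<le> h s * (1 / (s * sqrt s)) * (1 / (1 + s * u\<^sup>2))"
        using monoD[OF h(1) True] h(2) M s pos by (intro mult_mono le) auto
      also have "\<dots> = h s / (s * sqrt s * (1 + s * u\<^sup>2))" by simp
      finally show ?thesis using True s c
        by (simp add: ennreal_mult[symmetric] ennreal_leI del: ennreal_mult)
    qed simp
  qed
  finally show ?thesis .
qed

text \<open>The maximum is \<open>4 / e\<close>, at \<open>y = 1\<close>; four terms of the exponential series give \<open>e \<ge> 8 / 3\<close>, which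
  is exactly what the bound \<open>3 / 2\<close> needs.\<close>

lemma one_plus_square_le_exp:
  fixes y :: real
  assumes "0 \<le> y"
  shows "(1 + y)\<^sup>2 * exp (- y) \<le> 3 / 2"
proof -
  have "(1 + y) / 2 \<le> exp ((y - 1) / 2)"
    using exp_ge_add_one_self[of "(y - 1) / 2"] by (simp add: field_simps)
  then have "((1 + y) / 2)\<^sup>2 \<le> (exp ((y - 1) / 2))\<^sup>2"
    using assms by (intro power_mono) auto
  also have "\<dots> = exp (y - 1)" by (simp add: exp_double[symmetric])
  finally have "(1 + y)\<^sup>2 * exp (- y) \<le> 4 * exp (y - 1) * exp (- y)"
    by (simp add: power_divide)
  also have "\<dots> = 4 * exp (- 1)" by (simp add: exp_add[symmetric])
  also have "\<dots> \<le> 3 / 2"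
  proof -
    have "(\<Sum>k<4. (1::real) ^ k /\<^sub>R fact k) \<le> exp 1"
      unfolding exp_def by (rule sum_le_suminf[OF summable_exp_generic]) auto
    then have "8 / 3 \<le> exp (1::real)" by (simp add: eval_nat_numeral)
    then show ?thesis by (simp add: exp_minus field_simps)
  qed
  finally show ?thesis .
qed

text \<open>For \<open>L \<ge> 1\<close> the lower bound on the weight is used with \<open>M = L\<close>, and the exponential beats
  \<open>(1 + L u\<^sup>2)\<^sup>2\<close>, so that once more a profile \<open>1 / (1 + L u\<^sup>2)\<close> is integrated. The weight only
  contains \<open>s \<ge> 1\<close>; for \<open>L < 1\<close> it is used with \<open>M = 1\<close>, and the integrand is merely bounded.\<close>

lemma nn_integral_exp_div_path_weight_le:
  assumes h: "mono h" "\<And>t. 0 \<le> h t" and L: "0 \<le> L" and hL: "0 < h L"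
  shows "(\<integral>\<^sup>+u\<in>{0..1}. ennreal (exp (- L * u\<^sup>2)) / path_weight h u \<partial>lborel)
    \<le> ennreal (9 * pi / 8 / h L)"
proof -
  define M where "M = max 1 L"
  have M: "1 \<le> M" "L \<le> M" by (auto simp: M_def)
  have hM: "h L \<le> h M" "0 < h M" using monoD[OF h(1) M(2)] hL by auto
  have pos: "0 < 1 + M * u\<^sup>2" for u using M by (intro add_pos_nonneg) auto
  have ptw: "ennreal (exp (- L * u\<^sup>2)) / path_weight h u
      \<le> ennreal (3 / 2 / h M * (sqrt M * (1 + M * u\<^sup>2) * exp (- L * u\<^sup>2)))" for u
  proof -
    define w where "w = 2 * h M / (3 * sqrt M * (1 + M * u\<^sup>2))"
    have w: "0 < w" unfolding w_def using hM M pos by (intro divide_pos_pos mult_pos_pos) auto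
    have wle: "ennreal w \<le> path_weight h u" unfolding w_def by (intro path_weight_ge h M)
    have "ennreal (exp (- L * u\<^sup>2)) / path_weight h u \<le> ennreal (exp (- L * u\<^sup>2) / w)"
    proof (rule divide_le_posI_ennreal)
      show "0 < path_weight h u" using wle w by (meson ennreal_less_zero_iff less_le_trans)
      have "ennreal (exp (- L * u\<^sup>2)) = ennreal w * ennreal (exp (- L * u\<^sup>2) / w)"
        using w by (simp add: ennreal_mult[symmetric] del: ennreal_mult)
      also have "\<dots> \<le> path_weight h u * ennreal (exp (- L * u\<^sup>2) / w)"
        by (intro mult_right_mono wle) simp
      finally show "ennreal (exp (- L * u\<^sup>2)) \<le> path_weight h u * ennreal (exp (- L * u\<^sup>2) / w)" .
    qed
    also have "exp (- L * u\<^sup>2) / w = 3 / 2 / h M * (sqrt M * (1 + M * u\<^sup>2) * exp (- L * u\<^sup>2))"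
      using M hM pos[of u] by (simp add: w_def)
    finally show ?thesis .
  qed
  show ?thesis
  proof (cases "1 \<le> L")
    case True
    then have M_eq: "M = L" by (simp add: M_def)
    have "(\<integral>\<^sup>+u\<in>{0..1}. ennreal (exp (- L * u\<^sup>2)) / path_weight h u \<partial>lborel)
      \<le> (\<integral>\<^sup>+u. ennreal (9 / 4 * sqrt L / h L) * (ennreal (1 / (1 + L * u\<^sup>2)) * indicator {0..1} u) \<partial>lborel)"
    proof (rule nn_integral_mono)
      fix u :: real
      have "(1 + L * u\<^sup>2) * exp (- L * u\<^sup>2) = (1 + L * u\<^sup>2)\<^sup>2 * exp (- (L * u\<^sup>2)) / (1 + L * u\<^sup>2)"
        using pos[of u] by (simp add: M_eq power2_eq_square)
      also have "\<dots> \<le> 3 / 2 / (1 + L * u\<^sup>2)"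
        using pos[of u] L by (intro divide_right_mono one_plus_square_le_exp) (auto simp: M_eq)
      finally have le: "(1 + L * u\<^sup>2) * exp (- L * u\<^sup>2) \<le> 3 / 2 / (1 + L * u\<^sup>2)" .
      have "3 / 2 / h M * (sqrt M * (1 + M * u\<^sup>2) * exp (- L * u\<^sup>2))
          = 3 / 2 / h L * sqrt L * ((1 + L * u\<^sup>2) * exp (- L * u\<^sup>2))"
        by (simp add: M_eq)
      also have "\<dots> \<le> 3 / 2 / h L * sqrt L * (3 / 2 / (1 + L * u\<^sup>2))"
        using hL L by (intro mult_left_mono le) auto
      also have "\<dots> = 9 / 4 * sqrt L / h L * (1 / (1 + L * u\<^sup>2))" by simp
      finally have "3 / 2 / h M * (sqrt M * (1 + M * u\<^sup>2) * exp (- L * u\<^sup>2))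
        \<le> 9 / 4 * sqrt L / h L * (1 / (1 + L * u\<^sup>2))" .
      then have "ennreal (exp (- L * u\<^sup>2)) / path_weight h u
        \<le> ennreal (9 / 4 * sqrt L / h L * (1 / (1 + L * u\<^sup>2)))"
        using ptw[of u] by (meson ennreal_leI order_trans)
      also have "\<dots> = ennreal (9 / 4 * sqrt L / h L) * ennreal (1 / (1 + L * u\<^sup>2))"
        using hL L by (intro ennreal_mult) (auto intro!: divide_nonneg_nonneg add_nonneg_nonneg)
      finally show "ennreal (exp (- L * u\<^sup>2)) / path_weight h u * indicator {0..1} u
        \<le> ennreal (9 / 4 * sqrt L / h L) * (ennreal (1 / (1 + L * u\<^sup>2)) * indicator {0..1} u)"
        by (simp add: mult.assoc[symmetric] mult_right_mono)
    qed
    also have "\<dots> = ennreal (9 / 4 * sqrt L / h L) * (\<integral>\<^sup>+u\<in>{0..1}. ennreal (1 / (1 + L * u\<^sup>2)) \<partial>lborel)"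
      by (rule nn_integral_cmult) measurable
    also have "\<dots> \<le> ennreal (9 / 4 * sqrt L / h L) * ennreal (pi / 2 / sqrt L)"
      using True by (intro mult_left_mono nn_integral_inverse_quadratic_le) auto
    also have "\<dots> = ennreal (9 * pi / 8 / h L)"
      using True hL by (subst ennreal_mult[symmetric]) auto
    finally show ?thesis .
  next
    case False
    then have M1: "M = 1" by (simp add: M_def)
    have "(\<integral>\<^sup>+u\<in>{0..1}. ennreal (exp (- L * u\<^sup>2)) / path_weight h u \<partial>lborel)
      \<le> (\<integral>\<^sup>+u\<in>{0..1::real}. ennreal (3 / h L) \<partial>lborel)"
    proof (rule nn_integral_mono)
      fix u :: real
      show "ennreal (exp (- L * u\<^sup>2)) / path_weight h u * indicator {0..1} u \<le> ennreal (3 / h L) * indicator {0..1} u"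
      proof (cases "u \<in> {0..1}")
        case True
        have "3 / 2 / h M * (sqrt M * (1 + M * u\<^sup>2) * exp (- L * u\<^sup>2)) \<le> 3 / 2 / h M * ((1 + 1) * 1)"
          using True L hM unfolding M1
          by (intro mult_left_mono mult_mono) (auto simp: power_le_one mult_nonneg_nonneg)
        also have "\<dots> \<le> 3 / h L" using hM hL by (simp add: frac_le)
        finally have "ennreal (exp (- L * u\<^sup>2)) / path_weight h u \<le> ennreal (3 / h L)"
          using ptw[of u] by (meson ennreal_leI order_trans)
        then show ?thesis using True by simp
      qed simp
    qed
    also have "\<dots> = ennreal (3 / h L)" by (subst nn_integral_cmult_indicator) auto
    also have "\<dots> \<le> ennreal (9 * pi / 8 / h L)"
      using hL pi_gt3 by (intro ennreal_leI divide_right_mono) auto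
    finally show ?thesis .
  qed
qed

text \<open>Away from \<open>u = 0\<close> the weight is finite and positive, so \<open>G\<close> factors as \<open>\<surd>W * (G / \<surd>W)\<close>. At
  \<open>u = 0\<close> the weight may be infinite, where such a factorization fails; that point has measure zero.\<close>

lemma weighted_Cauchy_Schwarz:
  assumes h: "mono h" "\<And>t. 0 \<le> h t" and fin: "(\<integral>\<^sup>+s\<in>{1..}. ennreal (h s / s\<^sup>2) \<partial>lborel) < \<infinity>"
    and L: "0 < h L"
    and G[measurable]: "G \<in> borel_measurable borel" and G0: "\<And>u. 0 \<le> G u"
  shows "(\<integral>\<^sup>+u\<in>{0..1}. ennreal (G u) \<partial>lborel)\<^sup>2
    \<le> (\<integral>\<^sup>+u\<in>{0..1}. path_weight h u \<partial>lborel)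
      * (\<integral>\<^sup>+u\<in>{0..1}. ennreal ((G u)\<^sup>2) / path_weight h u \<partial>lborel)"
proof -
  note [measurable] = borel_measurable_path_weight[OF h(1)]
  define W where "W = (\<lambda>u. enn2real (path_weight h u))"
  have [measurable]: "W \<in> borel_measurable borel" unfolding W_def by measurable
  have w: "path_weight h u = ennreal (W u)" "0 < W u" if "u \<noteq> 0" for u
  proof -
    have lt: "path_weight h u < \<infinity>" by (rule path_weight_finite[OF h fin that])
    then show eq: "path_weight h u = ennreal (W u)" by (simp add: W_def)
    define M where "M = max 1 L"
    have M: "1 \<le> M" "L \<le> M" by (auto simp: M_def)
    have "0 < h M" using monoD[OF h(1) M(2)] L by simp
    then have "0 < 2 * h M / (3 * sqrt M * (1 + M * u\<^sup>2))"
      using M by (intro divide_pos_pos mult_pos_pos add_pos_nonneg) auto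
    moreover have "ennreal (2 * h M / (3 * sqrt M * (1 + M * u\<^sup>2))) \<le> ennreal (W u)"
      unfolding eq[symmetric] by (rule path_weight_ge[OF h M(1)])
    moreover have "0 \<le> W u" by (simp add: W_def)
    ultimately show "0 < W u" by (simp add: ennreal_le_iff2)
  qed
  have ae: "AE u in lborel. u \<noteq> (0::real)" by (rule AE_lborel_singleton)
  have split: "ennreal (G u) = ennreal (sqrt (W u)) * ennreal (G u / sqrt (W u))" if "u \<noteq> 0" for u
    using w(2)[OF that] G0[of u] by (subst ennreal_mult[symmetric]) auto
  have "(\<integral>\<^sup>+u\<in>{0..1}. ennreal (G u) \<partial>lborel)
      = (\<integral>\<^sup>+u. (ennreal (sqrt (W u)) * indicator {0..1} u)
          * (ennreal (G u / sqrt (W u)) * indicator {0..1} u) \<partial>lborel)"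
    using ae by (intro nn_integral_cong_AE, eventually_elim)
      (simp add: split indicator_def)
  then have "(\<integral>\<^sup>+u\<in>{0..1}. ennreal (G u) \<partial>lborel)\<^sup>2
      \<le> (\<integral>\<^sup>+u. (ennreal (sqrt (W u)) * indicator {0..1} u)\<^sup>2 \<partial>lborel)
        * (\<integral>\<^sup>+u. (ennreal (G u / sqrt (W u)) * indicator {0..1} u)\<^sup>2 \<partial>lborel)"
    by (simp only:) (rule Cauchy_Schwarz_nn_integral; measurable)
  also have "(\<integral>\<^sup>+u. (ennreal (sqrt (W u)) * indicator {0..1} u)\<^sup>2 \<partial>lborel)
      = (\<integral>\<^sup>+u\<in>{0..1}. path_weight h u \<partial>lborel)"
    using ae by (intro nn_integral_cong_AE, eventually_elim)
      (use w in \<open>auto simp: ennreal_power indicator_def less_imp_le\<close>)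
  also have "(\<integral>\<^sup>+u. (ennreal (G u / sqrt (W u)) * indicator {0..1} u)\<^sup>2 \<partial>lborel)
      = (\<integral>\<^sup>+u\<in>{0..1}. ennreal ((G u)\<^sup>2) / path_weight h u \<partial>lborel)"
    using ae by (intro nn_integral_cong_AE, eventually_elim)
      (use w G0 in \<open>auto simp: ennreal_power indicator_def less_imp_le divide_ennreal power_divide\<close>)
  finally show ?thesis .
qed

text \<open>The mean value inequality against an antiderivative of the speed. It involves no integral
  of a vector-valued function and hence no completeness.\<close>

lemma norm_diff_le_nn_integral:
  fixes F :: "real \<Rightarrow> 'a::real_normed_vector"
  assumes F: "\<And>u. (F has_vector_derivative F' u) (at u)" and F': "continuous_on UNIV F'"
  shows "ennreal (norm (F 1 - F 0)) \<le> (\<integral>\<^sup>+u\<in>{0..1}. ennreal (norm (F' u)) \<partial>lborel)"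
proof -
  have cont: "continuous_on UNIV (\<lambda>u. norm (F' u))"
    using F' by (intro continuous_intros)
  \<comment> \<open>the larger interval makes \<open>\<Phi>\<close> differentiable from both sides on \<open>[0, 1]\<close>\<close>
  obtain \<Phi> where \<Phi>: "\<And>u. u \<in> {-1..2} \<Longrightarrow>
      (\<Phi> has_vector_derivative norm (F' u)) (at u within {-1..2::real})"
    using antiderivative_continuous[OF continuous_on_subset[OF cont subset_UNIV]] by blast
  have d\<Phi>: "(\<Phi> has_vector_derivative norm (F' u)) (at u)" if "u \<in> {0..1}" for u
    using \<Phi>[of u] at_within_interior[of u "{-1..2}"] that by auto
  have cont\<Phi>: "continuous_on {0..1} \<Phi>"
    using d\<Phi> by (intro continuous_at_imp_continuous_on ballI)
      (blast intro: has_vector_derivative_continuous)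
  have contF: "continuous_on {0..1} F"
    using F by (intro continuous_at_imp_continuous_on ballI)
      (blast intro: has_vector_derivative_continuous)
  have "norm (F 1 - F 0) \<le> \<Phi> 1 - \<Phi> 0"
    by (rule differentiable_bound_general[OF _ contF cont\<Phi> F d\<Phi>]) auto
  then have "ennreal (norm (F 1 - F 0)) \<le> ennreal (\<Phi> 1 - \<Phi> 0)" by (rule ennreal_leI)
  also have "\<dots> = (\<integral>\<^sup>+u\<in>{0..1}. ennreal (norm (F' u)) \<partial>lborel)"
    using d\<Phi> borel_measurable_continuous_onI[OF cont]
    by (intro nn_integral_FTC_Icc[symmetric])
      (auto simp: has_real_derivative_iff_has_vector_derivative)
  finally show ?thesis .
qed

section \<open>The interpolation path and Talagrand's inequality\<close>

text \<open>Concavity of the sine: the graph lies above the chord.\<close>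

lemma le_sin_half_pi:
  fixes u :: real
  assumes u: "0 \<le> u" "u \<le> 1"
  shows "u \<le> sin (pi / 2 * u)"
proof -
  have "convex_on {0..pi / 2} (\<lambda>x. - sin x)"
    by (rule f''_ge0_imp_convex[where f' = "\<lambda>x. - cos x" and f'' = sin])
      (auto intro!: derivative_eq_intros sin_ge_zero)
  from convex_onD_Icc[OF this _ u] show ?thesis by (simp add: mult.commute)
qed

lemma has_vector_derivative_noise_path:
  fixes f :: "(nat \<Rightarrow> real) \<Rightarrow> 'a::real_normed_vector"
  shows "((\<lambda>u. noise n ((cos (pi / 2 * u))\<^sup>2) f \<epsilon>) has_vector_derivative
    (- pi * cos (pi / 2 * u) * sin (pi / 2 * u)) *\<^sub>R noise_deriv n ((cos (pi / 2 * u))\<^sup>2) f \<epsilon>) (at u)"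
proof -
  have "((\<lambda>u. (cos (pi / 2 * u))\<^sup>2) has_real_derivative - pi * cos (pi / 2 * u) * sin (pi / 2 * u)) (at u)"
    by (auto intro!: derivative_eq_intros)
  then have "((\<lambda>u. (cos (pi / 2 * u))\<^sup>2) has_vector_derivative - pi * cos (pi / 2 * u) * sin (pi / 2 * u)) (at u)"
    by (simp add: has_real_derivative_iff_has_vector_derivative)
  from vector_diff_chain_at[OF this has_vector_derivative_noise, of n f \<epsilon>]
  show ?thesis by (simp add: o_def)
qed

lemma continuous_on_noise_path_deriv:
  fixes f :: "(nat \<Rightarrow> real) \<Rightarrow> 'a::real_normed_vector"
  shows "continuous_on UNIV (\<lambda>u. (- pi * cos (pi / 2 * u) * sin (pi / 2 * u)) *\<^sub>R
    noise_deriv n ((cos (pi / 2 * u))\<^sup>2) f \<epsilon>)"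
  unfolding noise_deriv_def noise_kernel_deriv_def expect_def by (intro continuous_intros)

text \<open>With \<open>r = cos(\<pi> u / 2)\<close>, the square of the chain rule factor is \<open>\<pi>\<^sup>2 r\<^sup>2 (1 - r\<^sup>2)\<close>, which up to
  \<open>\<pi>\<^sup>2\<close> is the factor on the left of \<open>noise_deriv_bound\<close>. What that leaves is \<open>T\<^sub>r D\<^sub>j f\<close>, on
  which the smoothing estimate acts.\<close>

lemma noise_path_deriv_bound:
  fixes f :: "(nat \<Rightarrow> real) \<Rightarrow> 'a::real_normed_vector"
  assumes T: "type2_bound TYPE('a) T" and n: "1 \<le> n" and u: "0 \<le> u" "u \<le> 1"
  defines "J \<equiv> {j\<in>{1..n}. \<not> (\<forall>\<epsilon>\<in>cube n. discrete_deriv j f \<epsilon> = 0)}"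
    and "L \<equiv> (\<lambda>j. ln (cube_norm n 2 (discrete_deriv j f) / cube_norm n 1 (discrete_deriv j f)))"
  shows "expect n (\<lambda>\<epsilon>. (norm ((- pi * cos (pi / 2 * u) * sin (pi / 2 * u)) *\<^sub>R
      noise_deriv n ((cos (pi / 2 * u))\<^sup>2) f \<epsilon>))\<^sup>2)
    \<le> (\<Sum>j\<in>J. 2 * pi\<^sup>2 * T\<^sup>2 * (cube_norm n 2 (discrete_deriv j f))\<^sup>2 * exp (- L j * u\<^sup>2))"
proof (cases "u = 0")
  case True
  then show ?thesis by (auto intro!: sum_nonneg)
next
  case False
  define r where "r = cos (pi / 2 * u)"
  define s where "s = sin (pi / 2 * u)"
  have s2: "s\<^sup>2 = 1 - r\<^sup>2"
    using sin_squared_eq[of "pi / 2 * u"] by (simp add: r_def s_def)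
  have us: "u \<le> s" unfolding s_def by (rule le_sin_half_pi[OF u])
  have u2: "u\<^sup>2 \<le> 1 - r\<^sup>2" unfolding s2[symmetric] using us u by (intro power_mono) auto
  have "0 < u\<^sup>2" using False by simp
  then have "r\<^sup>2 < 1" using u2 by linarith
  then have r: "\<bar>r\<bar> < 1" by (simp add: abs_square_less_1)
  have decay: "expect n (\<lambda>\<epsilon>. (norm (noise n r (discrete_deriv j f) \<epsilon>))\<^sup>2)
      \<le> (if j \<in> J then (cube_norm n 2 (discrete_deriv j f))\<^sup>2 * exp (- L j * u\<^sup>2) else 0)"
    if j: "j \<in> {1..n}" for j
  proof (cases "j \<in> J")
    case True
    then have nz: "\<not> (\<forall>\<epsilon>\<in>cube n. discrete_deriv j f \<epsilon> = 0)" by (simp add: J_def)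
    have "0 \<le> L j" unfolding L_def by (rule log_norm_ratio_nonneg[OF nz])
    then have "L j * u\<^sup>2 \<le> L j * (1 - r\<^sup>2)" using u2 by (intro mult_left_mono)
    then have "exp (- L j * (1 - r\<^sup>2)) \<le> exp (- L j * u\<^sup>2)" by simp
    then have "(cube_norm n 2 (discrete_deriv j f))\<^sup>2 * exp (- L j * (1 - r\<^sup>2))
        \<le> (cube_norm n 2 (discrete_deriv j f))\<^sup>2 * exp (- L j * u\<^sup>2)"
      by (intro mult_left_mono) auto
    with noise_norm_decay[OF _ nz, of r] r True show ?thesis by (simp add: L_def)
  next
    case False
    then have "noise n r (discrete_deriv j f) \<epsilon> = 0" for \<epsilon>
      using j by (simp add: J_def noise_def cong: expect_cong)
    then show ?thesis using False by simp
  qed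
  have "expect n (\<lambda>\<epsilon>. (norm ((- pi * r * s) *\<^sub>R noise_deriv n (r\<^sup>2) f \<epsilon>))\<^sup>2)
      = pi\<^sup>2 * (r\<^sup>2 * (1 - r\<^sup>2) * expect n (\<lambda>\<epsilon>. (norm (noise_deriv n (r\<^sup>2) f \<epsilon>))\<^sup>2))"
    unfolding norm_scaleR power_mult_distrib power2_abs s2 expect_mult by (simp add: power_mult_distrib)
  also have "\<dots> \<le> pi\<^sup>2 * (2 * T\<^sup>2 * (\<Sum>j = 1..n. expect n (\<lambda>\<epsilon>. (norm (noise n r (discrete_deriv j f) \<epsilon>))\<^sup>2)))"
    by (intro mult_left_mono noise_deriv_bound T n r) auto
  also have "\<dots> \<le> pi\<^sup>2 * (2 * T\<^sup>2 * (\<Sum>j = 1..n.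
      if j \<in> J then (cube_norm n 2 (discrete_deriv j f))\<^sup>2 * exp (- L j * u\<^sup>2) else 0))"
    by (intro mult_left_mono sum_mono decay) auto
  also have "(\<Sum>j = 1..n. if j \<in> J then (cube_norm n 2 (discrete_deriv j f))\<^sup>2 * exp (- L j * u\<^sup>2) else 0)
      = (\<Sum>j\<in>J. (cube_norm n 2 (discrete_deriv j f))\<^sup>2 * exp (- L j * u\<^sup>2))"
    by (intro sum.mono_neutral_cong_right) (auto simp: J_def)
  finally show ?thesis by (simp add: r_def s_def sum_distrib_left mult_ac)
qed

lemma ennreal_expect:
  assumes "\<And>\<epsilon>. \<epsilon> \<in> cube n \<Longrightarrow> 0 \<le> g \<epsilon>"
  shows "ennreal (expect n g) = (\<Sum>\<epsilon>\<in>cube n. ennreal (1 / real (card (cube n))) * ennreal (g \<epsilon>))"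
proof -
  have "expect n g = (\<Sum>\<epsilon>\<in>cube n. 1 / real (card (cube n)) * g \<epsilon>)"
    by (simp add: expect_def sum_divide_distrib)
  then show ?thesis using assms by (simp add: sum_ennreal[symmetric] ennreal_mult'[symmetric] del: sum_ennreal)
qed

text \<open>Cauchy-Schwarz is applied along the path of each point \<open>\<epsilon>\<close> before averaging, so that the average
  over the cube falls on the squared speed, where the bound on its second moment is available.\<close>

lemma talagrand_type2_ennreal:
  fixes f :: "(nat \<Rightarrow> real) \<Rightarrow> 'a::real_normed_vector"
  assumes h: "mono h" "\<And>t. 0 \<le> h t"
    and fin: "(\<integral>\<^sup>+s\<in>{1..}. ennreal (h s / s\<^sup>2) \<partial>lborel) < \<infinity>" and h0: "0 < h t0"
    and T: "type2_bound TYPE('a) T" and n: "1 \<le> n"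
  defines "J \<equiv> {j\<in>{1..n}. \<not> (\<forall>\<epsilon>\<in>cube n. discrete_deriv j f \<epsilon> = 0)}"
    and "L \<equiv> (\<lambda>j. ln (cube_norm n 2 (discrete_deriv j f) / cube_norm n 1 (discrete_deriv j f)))"
  assumes hL: "\<And>j. j \<in> J \<Longrightarrow> 0 < h (L j)"
  shows "ennreal (expect n (\<lambda>\<epsilon>. (norm (f \<epsilon> - expect n f))\<^sup>2))
    \<le> (\<integral>\<^sup>+s\<in>{1..}. ennreal (h s / s\<^sup>2) \<partial>lborel) *
      ennreal (9 / 8 * pi ^ 4 * T\<^sup>2 * (\<Sum>j\<in>J. (cube_norm n 2 (discrete_deriv j f))\<^sup>2 / h (L j)))"
proof -
  note [measurable] = borel_measurable_path_weight[OF h(1)]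
  define F' where "F' = (\<lambda>\<epsilon> u. (- pi * cos (pi / 2 * u) * sin (pi / 2 * u)) *\<^sub>R
      noise_deriv n ((cos (pi / 2 * u))\<^sup>2) f \<epsilon>)"
  define c where "c = (\<lambda>j. 2 * pi\<^sup>2 * T\<^sup>2 * (cube_norm n 2 (discrete_deriv j f))\<^sup>2)"
  define A where "A = (\<integral>\<^sup>+u\<in>{0..1}. path_weight h u \<partial>lborel)"
  let ?p = "ennreal (1 / real (card (cube n)))"
  have c0: "0 \<le> c j" for j by (simp add: c_def)
  have contF': "continuous_on UNIV (F' \<epsilon>)" for \<epsilon>
    unfolding F'_def by (rule continuous_on_noise_path_deriv)
  then have [measurable]: "(\<lambda>u. norm (F' \<epsilon> u)) \<in> borel_measurable borel" for \<epsilon>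
    by (intro borel_measurable_continuous_onI continuous_intros)
  have ptw: "ennreal ((norm (f \<epsilon> - expect n f))\<^sup>2)
      \<le> A * (\<integral>\<^sup>+u\<in>{0..1}. ennreal ((norm (F' \<epsilon> u))\<^sup>2) / path_weight h u \<partial>lborel)" if e: "\<epsilon> \<in> cube n" for \<epsilon>
  proof -
    have "ennreal (norm (noise n ((cos (pi / 2 * 1))\<^sup>2) f \<epsilon> - noise n ((cos (pi / 2 * 0))\<^sup>2) f \<epsilon>))
        \<le> (\<integral>\<^sup>+u\<in>{0..1}. ennreal (norm (F' \<epsilon> u)) \<partial>lborel)"
      unfolding F'_def
      by (rule norm_diff_le_nn_integral[OF has_vector_derivative_noise_path continuous_on_noise_path_deriv])
    then have "ennreal (norm (f \<epsilon> - expect n f)) \<le> (\<integral>\<^sup>+u\<in>{0..1}. ennreal (norm (F' \<epsilon> u)) \<partial>lborel)"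
      by (simp add: noise_at_0 noise_at_1[OF e] norm_minus_commute)
    then have "(ennreal (norm (f \<epsilon> - expect n f)))\<^sup>2 \<le> (\<integral>\<^sup>+u\<in>{0..1}. ennreal (norm (F' \<epsilon> u)) \<partial>lborel)\<^sup>2"
      by (intro power_mono) auto
    also have "\<dots> \<le> A * (\<integral>\<^sup>+u\<in>{0..1}. ennreal ((norm (F' \<epsilon> u))\<^sup>2) / path_weight h u \<partial>lborel)"
      unfolding A_def by (rule weighted_Cauchy_Schwarz[OF h fin h0]) auto
    finally show ?thesis by (simp add: ennreal_power)
  qed
  have "ennreal (expect n (\<lambda>\<epsilon>. (norm (f \<epsilon> - expect n f))\<^sup>2))
      = (\<Sum>\<epsilon>\<in>cube n. ?p * ennreal ((norm (f \<epsilon> - expect n f))\<^sup>2))"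
    by (rule ennreal_expect) simp
  also have "\<dots> \<le> (\<Sum>\<epsilon>\<in>cube n. ?p * (A * (\<integral>\<^sup>+u\<in>{0..1}. ennreal ((norm (F' \<epsilon> u))\<^sup>2) / path_weight h u \<partial>lborel)))"
    by (intro sum_mono mult_left_mono ptw) auto
  also have "\<dots> = A * (\<Sum>\<epsilon>\<in>cube n. ?p * (\<integral>\<^sup>+u\<in>{0..1}. ennreal ((norm (F' \<epsilon> u))\<^sup>2) / path_weight h u \<partial>lborel))"
    by (simp add: sum_distrib_left mult_ac)
  also have "(\<Sum>\<epsilon>\<in>cube n. ?p * (\<integral>\<^sup>+u\<in>{0..1}. ennreal ((norm (F' \<epsilon> u))\<^sup>2) / path_weight h u \<partial>lborel))
      = (\<integral>\<^sup>+u. (\<Sum>\<epsilon>\<in>cube n. ?p * (ennreal ((norm (F' \<epsilon> u))\<^sup>2) / path_weight h u * indicator {0..1} u)) \<partial>lborel)"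
    by (subst nn_integral_sum, measurable) (intro sum.cong refl nn_integral_cmult[symmetric], measurable)
  also have "\<dots> = (\<integral>\<^sup>+u\<in>{0..1}. ennreal (expect n (\<lambda>\<epsilon>. (norm (F' \<epsilon> u))\<^sup>2)) / path_weight h u \<partial>lborel)"
    by (intro nn_integral_cong, subst ennreal_expect)
      (auto simp: divide_ennreal_def sum_distrib_left sum_distrib_right mult_ac)
  also have "\<dots> \<le> (\<integral>\<^sup>+u. (\<Sum>j\<in>J. ennreal (c j) *
      (ennreal (exp (- L j * u\<^sup>2)) / path_weight h u * indicator {0..1} u)) \<partial>lborel)"
  proof (rule nn_integral_mono)
    fix u :: real
    show "ennreal (expect n (\<lambda>\<epsilon>. (norm (F' \<epsilon> u))\<^sup>2)) / path_weight h u * indicator {0..1} u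
      \<le> (\<Sum>j\<in>J. ennreal (c j) * (ennreal (exp (- L j * u\<^sup>2)) / path_weight h u * indicator {0..1} u))"
    proof (cases "u \<in> {0..1}")
      case True
      then have "expect n (\<lambda>\<epsilon>. (norm (F' \<epsilon> u))\<^sup>2) \<le> (\<Sum>j\<in>J. c j * exp (- L j * u\<^sup>2))"
        unfolding F'_def c_def J_def L_def by (intro noise_path_deriv_bound T n) auto
      then have "ennreal (expect n (\<lambda>\<epsilon>. (norm (F' \<epsilon> u))\<^sup>2)) \<le> (\<Sum>j\<in>J. ennreal (c j) * ennreal (exp (- L j * u\<^sup>2)))"
        using c0 by (simp add: ennreal_mult[symmetric] ennreal_leI)
      then have "ennreal (expect n (\<lambda>\<epsilon>. (norm (F' \<epsilon> u))\<^sup>2)) / path_weight h u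
          \<le> (\<Sum>j\<in>J. ennreal (c j) * ennreal (exp (- L j * u\<^sup>2))) / path_weight h u"
        by (rule divide_right_mono_ennreal)
      then show ?thesis using True
        by (simp add: divide_ennreal_def sum_distrib_left sum_distrib_right mult_ac)
    qed simp
  qed
  also have "\<dots> = (\<Sum>j\<in>J. ennreal (c j) *
      (\<integral>\<^sup>+u\<in>{0..1}. ennreal (exp (- L j * u\<^sup>2)) / path_weight h u \<partial>lborel))"
    by (subst nn_integral_sum, measurable) (intro sum.cong refl nn_integral_cmult, measurable)
  also have "\<dots> \<le> (\<Sum>j\<in>J. ennreal (c j) * ennreal (9 * pi / 8 / h (L j)))"
  proof (intro sum_mono mult_left_mono)
    fix j assume j: "j \<in> J"
    have "0 \<le> L j" unfolding L_def using j by (intro log_norm_ratio_nonneg) (simp add: J_def)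
    then show "(\<integral>\<^sup>+u\<in>{0..1}. ennreal (exp (- L j * u\<^sup>2)) / path_weight h u \<partial>lborel)
        \<le> ennreal (9 * pi / 8 / h (L j))"
      by (intro nn_integral_exp_div_path_weight_le h hL j)
  qed simp
  also have "\<dots> = ennreal (\<Sum>j\<in>J. c j * (9 * pi / 8 / h (L j)))"
    using c0 h(2) by (simp add: ennreal_mult[symmetric])
  finally have "ennreal (expect n (\<lambda>\<epsilon>. (norm (f \<epsilon> - expect n f))\<^sup>2))
      \<le> A * ennreal (\<Sum>j\<in>J. c j * (9 * pi / 8 / h (L j)))"
    by (simp add: mult_left_mono)
  also have "\<dots> \<le> (ennreal (pi / 2) * (\<integral>\<^sup>+s\<in>{1..}. ennreal (h s / s\<^sup>2) \<partial>lborel))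
      * ennreal (\<Sum>j\<in>J. c j * (9 * pi / 8 / h (L j)))"
    unfolding A_def by (intro mult_right_mono nn_integral_path_weight_le h) auto
  also have "\<dots> = (\<integral>\<^sup>+s\<in>{1..}. ennreal (h s / s\<^sup>2) \<partial>lborel)
      * ennreal (pi / 2 * (\<Sum>j\<in>J. c j * (9 * pi / 8 / h (L j))))"
  proof -
    have "0 \<le> (\<Sum>j\<in>J. c j * (9 * pi / 8 / h (L j)))"
      using c0 h(2) by (intro sum_nonneg) simp
    then have "ennreal (pi / 2 * (\<Sum>j\<in>J. c j * (9 * pi / 8 / h (L j))))
        = ennreal (pi / 2) * ennreal (\<Sum>j\<in>J. c j * (9 * pi / 8 / h (L j)))"
      by (intro ennreal_mult) auto
    then show ?thesis by (simp only: mult_ac)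
  qed
  also have "pi / 2 * (\<Sum>j\<in>J. c j * (9 * pi / 8 / h (L j)))
      = 9 / 8 * pi ^ 4 * T\<^sup>2 * (\<Sum>j\<in>J. (cube_norm n 2 (discrete_deriv j f))\<^sup>2 / h (L j))"
    unfolding sum_distrib_left by (intro sum.cong refl) (simp add: c_def eval_nat_numeral)
  finally show ?thesis .
qed

lemma type2_const_nonneg:
  assumes "has_type2 TYPE('a::real_normed_vector)"
  shows "0 \<le> type2_const TYPE('a)"
  using assms unfolding has_type2_def type2_const_def by (intro cInf_greatest) auto

text \<open>The infimum defining the type constant is attained, each single inequality being closed in \<open>T\<close>.\<close>

lemma type2_bound_type2_const:
  assumes "has_type2 TYPE('a::real_normed_vector)"
  shows "type2_bound TYPE('a) (type2_const TYPE('a))"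
  unfolding type2_bound_def
proof (intro allI impI)
  fix n :: nat and x :: "nat \<Rightarrow> 'a" assume n: "1 \<le> n"
  define A where "A = expect n (\<lambda>\<epsilon>. (norm (\<Sum>j = 1..n. \<epsilon> j *\<^sub>R x j))\<^sup>2)"
  define B where "B = (\<Sum>j = 1..n. (norm (x j))\<^sup>2)"
  have le: "A \<le> T\<^sup>2 * B" if "type2_bound TYPE('a) T" for T
    using that n by (simp add: type2_bound_def A_def B_def)
  obtain T0 where T0: "0 \<le> T0" "type2_bound TYPE('a) T0" using assms by (auto simp: has_type2_def)
  have B0: "0 \<le> B" by (simp add: B_def sum_nonneg)
  have "A \<le> (type2_const TYPE('a))\<^sup>2 * B"
  proof (cases "B = 0")
    case True
    then show ?thesis using le[OF T0(2)] by simp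
  next
    case False
    then have B: "0 < B" using B0 by simp
    have "sqrt (A / B) \<le> type2_const TYPE('a)"
      unfolding type2_const_def
    proof (rule cInf_greatest)
      show "{T. 0 \<le> T \<and> type2_bound TYPE('a) T} \<noteq> {}" using T0 by blast
      fix T assume "T \<in> {T. 0 \<le> T \<and> type2_bound TYPE('a) T}"
      then show "sqrt (A / B) \<le> T" using le[of T] B by (intro real_le_lsqrt) (auto simp: field_simps)
    qed
    then have "A / B \<le> (type2_const TYPE('a))\<^sup>2" by (rule sqrt_le_D)
    then show ?thesis using B by (simp add: field_simps)
  qed
  then show "expect n (\<lambda>\<epsilon>. (norm (\<Sum>j = 1..n. \<epsilon> j *\<^sub>R x j))\<^sup>2)
      \<le> (type2_const TYPE('a))\<^sup>2 * (\<Sum>j = 1..n. (norm (x j))\<^sup>2)"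
    by (simp add: A_def B_def)
qed

lemma type2_bound_0_trivial:
  fixes x :: "'a::real_normed_vector"
  assumes "type2_bound TYPE('a) 0"
  shows "x = 0"
proof -
  have "expect 1 (\<lambda>\<epsilon>. (norm (\<Sum>j = 1..1::nat. \<epsilon> j *\<^sub>R x))\<^sup>2) \<le> 0"
    using assms[unfolded type2_bound_def, rule_format, of 1 "\<lambda>_. x"] by simp
  moreover have "expect 1 (\<lambda>\<epsilon>. (norm (\<Sum>j = 1..1::nat. \<epsilon> j *\<^sub>R x))\<^sup>2) = expect 1 (\<lambda>_. (norm x)\<^sup>2)"
  proof (rule expect_cong)
    fix \<epsilon> assume "\<epsilon> \<in> cube 1"
    from cube_coord[OF this, of 1] show "(norm (\<Sum>j = 1..1::nat. \<epsilon> j *\<^sub>R x))\<^sup>2 = (norm x)\<^sup>2" by auto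
  qed
  ultimately have "(norm x)\<^sup>2 \<le> 0" by simp
  then show ?thesis by simp
qed

lemma pi_power4_bound: "9 / 8 * pi ^ 4 \<le> (144::real)"
proof -
  have "pi \<le> 16 / 5" using pi_approx by simp
  then have "pi ^ 4 \<le> (16 / 5) ^ 4" by (intro power_mono) auto
  then show ?thesis by (simp add: eval_nat_numeral)
qed

theorem theorem3:
  fixes h :: "real \<Rightarrow> real"
    and n :: nat
    and f :: "(nat \<Rightarrow> real) \<Rightarrow> 'a::real_normed_vector"
  assumes h_nonneg: "\<And>t. 0 \<le> t \<Longrightarrow> 0 \<le> h t"
    and h_mono: "mono_on {0..} h"
    and h_int_pos: "0 < (\<integral>\<^sup>+t\<in>{1..}. ennreal (h t / t\<^sup>2) \<partial>lborel)"
    and h_int_finite: "(\<integral>\<^sup>+t\<in>{1..}. ennreal (h t / t\<^sup>2) \<partial>lborel) < \<infinity>"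
    and type2: "has_type2 TYPE('a)"
    and n: "n \<ge> 1"
  shows "ennreal (cube_norm n 2 (\<lambda>\<epsilon>. f \<epsilon> - expect n f))
    \<le> 12 * ennreal (type2_const TYPE('a))
        * ennreal_sqrt (\<integral>\<^sup>+t\<in>{1..}. ennreal (h t / t\<^sup>2) \<partial>lborel)
        * ennreal_sqrt (\<Sum>j = 1..n. talagrand_term h n f j)"
proof -
  define T where "T = type2_const TYPE('a)"
  have T: "0 \<le> T" "type2_bound TYPE('a) T"
    using type2 by (auto simp: T_def type2_const_nonneg type2_bound_type2_const)
  define H where "H = (\<integral>\<^sup>+t\<in>{1..}. ennreal (h t / t\<^sup>2) \<partial>lborel)"
  define Hr where "Hr = enn2real H"
  have H: "H = ennreal Hr" "0 < Hr"
    using h_int_pos h_int_finite by (auto simp: Hr_def H_def enn2real_positive_iff)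
  have sqrtH: "ennreal_sqrt H = ennreal (sqrt Hr)"
    using H by (simp add: ennreal_sqrt_def)
  define J where "J = {j\<in>{1..n}. \<not> (\<forall>\<epsilon>\<in>cube n. discrete_deriv j f \<epsilon> = 0)}"
  define L where "L = (\<lambda>j. ln (cube_norm n 2 (discrete_deriv j f) / cube_norm n 1 (discrete_deriv j f)))"
  have L: "0 \<le> L j" if "j \<in> J" for j
    unfolding L_def using that by (intro log_norm_ratio_nonneg) (simp add: J_def)
  have J: "finite J" "J \<subseteq> {1..n}" by (auto simp: J_def)
  have term0: "talagrand_term h n f j = 0" if "j \<in> {1..n} - J" for j
    using that by (simp add: talagrand_term_def J_def)
  have term1: "talagrand_term h n f j =
      (if h (L j) = 0 then \<infinity> else ennreal ((cube_norm n 2 (discrete_deriv j f))\<^sup>2 / h (L j)))"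
    if "j \<in> J" for j
  proof -
    have nz: "\<not> (\<forall>\<epsilon>\<in>cube n. discrete_deriv j f \<epsilon> = 0)" using that by (simp add: J_def)
    show ?thesis unfolding talagrand_term_def Let_def L_def if_not_P[OF nz] ..
  qed
  have sum: "(\<Sum>j = 1..n. talagrand_term h n f j) = (\<Sum>j\<in>J. talagrand_term h n f j)"
    using J term0 by (intro sum.mono_neutral_right) auto
  show ?thesis
  \<comment> \<open>here the right-hand side may be \<open>0 * \<infinity> = 0\<close>, so the space has to be trivial\<close>
  proof (cases "T = 0")
    case True
    then have "x = 0" for x :: 'a using T type2_bound_0_trivial by blast
    then have "norm (f \<epsilon> - expect n f) = 0" for \<epsilon> by simp
    then show ?thesis by (simp add: cube_norm_2)
  next
    case False
    then have Tpos: "0 < T" using T by simp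
    show ?thesis
    proof (cases "\<exists>j\<in>J. h (L j) = 0")
      case True
      then obtain j where j: "j \<in> J" "h (L j) = 0" by blast
      then have "(\<Sum>j\<in>J. talagrand_term h n f j) = \<infinity>"
        using J term1[OF j(1)] by (simp add: sum.remove[OF J(1) j(1)])
      then show ?thesis
        using Tpos H sqrtH unfolding sum T_def[symmetric] H_def[symmetric]
        by (simp add: ennreal_sqrt_def ennreal_mult_eq_top_iff ennreal_mult_top)
    next
      case False
      then have hL: "0 < h (L j)" if "j \<in> J" for j
        using h_nonneg[OF L[OF that]] that by force
      define S where "S = (\<Sum>j\<in>J. (cube_norm n 2 (discrete_deriv j f))\<^sup>2 / h (L j))"
      have S0: "0 \<le> S" unfolding S_def using hL by (intro sum_nonneg divide_nonneg_pos) auto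
      have "(\<Sum>j\<in>J. talagrand_term h n f j)
          = (\<Sum>j\<in>J. ennreal ((cube_norm n 2 (discrete_deriv j f))\<^sup>2 / h (L j)))"
        using hL term1 by (intro sum.cong) force+
      also have "\<dots> = ennreal S"
        unfolding S_def using hL by (intro sum_ennreal divide_nonneg_pos) auto
      finally have sumS: "ennreal_sqrt (\<Sum>j = 1..n. talagrand_term h n f j) = ennreal (sqrt S)"
        unfolding sum using S0 by (simp only:) (simp add: ennreal_sqrt_def)
      \<comment> \<open>\<open>h\<close> is unconstrained on the negative axis; \<open>k\<close> is a globally monotone version\<close>
      define k where "k = (\<lambda>t. h (max 0 t))"
      have k: "mono k" "\<And>t. 0 \<le> k t"
        unfolding k_def by (auto intro!: monoI mono_onD[OF h_mono] h_nonneg)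
      have kH: "(\<integral>\<^sup>+t\<in>{1..}. ennreal (k t / t\<^sup>2) \<partial>lborel) = H"
        unfolding H_def k_def by (intro nn_integral_cong) (auto simp: indicator_def max_def)
      have "\<exists>t. 0 < k t"
      proof (rule ccontr)
        assume "\<not> (\<exists>t. 0 < k t)"
        then have "k t = 0" for t using k(2)[of t] by (metis less_eq_real_def)
        then have "H = 0" unfolding kH[symmetric] by simp
        then show False using H by simp
      qed
      then obtain t0 where t0: "0 < k t0" by blast
      have kL: "k (L j) = h (L j)" if "j \<in> J" for j using L[OF that] by (simp add: k_def)
      define V where "V = expect n (\<lambda>\<epsilon>. (norm (f \<epsilon> - expect n f))\<^sup>2)"
      have "ennreal V \<le> H * ennreal (9 / 8 * pi ^ 4 * T\<^sup>2 *
          (\<Sum>j\<in>J. (cube_norm n 2 (discrete_deriv j f))\<^sup>2 / k (L j)))"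
        unfolding V_def kH[symmetric] J_def L_def
      proof (rule talagrand_type2_ennreal[OF k _ t0 T(2) n])
        show "(\<integral>\<^sup>+t\<in>{1..}. ennreal (k t / t\<^sup>2) \<partial>lborel) < \<infinity>"
          using h_int_finite unfolding kH H_def .
        fix j assume "j \<in> {j \<in> {1..n}. \<not> (\<forall>\<epsilon>\<in>cube n. discrete_deriv j f \<epsilon> = 0)}"
        then have "j \<in> J" by (simp add: J_def)
        then show "0 < k (ln (cube_norm n 2 (discrete_deriv j f) / cube_norm n 1 (discrete_deriv j f)))"
          using hL kL unfolding L_def by simp
      qed
      also have "(\<Sum>j\<in>J. (cube_norm n 2 (discrete_deriv j f))\<^sup>2 / k (L j)) = S"
        unfolding S_def by (intro sum.cong) (simp_all add: kL)
      also have "H * ennreal (9 / 8 * pi ^ 4 * T\<^sup>2 * S) = ennreal (Hr * (9 / 8 * pi ^ 4 * T\<^sup>2 * S))"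
        unfolding H(1) using H(2) S0 by (intro ennreal_mult[symmetric]) auto
      finally have "V \<le> Hr * (9 / 8 * pi ^ 4 * T\<^sup>2 * S)"
        using H(2) S0 by (subst (asm) ennreal_le_iff) auto
      also have "\<dots> = 9 / 8 * pi ^ 4 * (Hr * T\<^sup>2 * S)" by simp
      also have "\<dots> \<le> 144 * (Hr * T\<^sup>2 * S)"
        using H(2) S0 by (intro mult_right_mono pi_power4_bound) auto
      also have "\<dots> = (12 * T * sqrt Hr * sqrt S)\<^sup>2"
        using H(2) S0 by (simp add: power_mult_distrib)
      finally have "sqrt V \<le> 12 * T * sqrt Hr * sqrt S"
        using T H(2) S0 by (intro real_le_lsqrt) auto
      then have "ennreal (sqrt V) \<le> ennreal (12 * T * sqrt Hr * sqrt S)" by (rule ennreal_leI)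
      also have "\<dots> = 12 * ennreal T * ennreal (sqrt Hr) * ennreal (sqrt S)"
        using T H(2) S0 by (simp add: ennreal_mult)
      finally show ?thesis
        unfolding sumS H_def[symmetric] sqrtH T_def[symmetric] by (simp add: cube_norm_2 V_def)
    qed
  qed
qed

end
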